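(* Assume that $K$ is a compact metric space and $n\in\mathbb{N}^+$ is such that $n\leq\dim_T K<\infty$. Then for a generic $f\in C(K,\mathbb{R}^n)$ there is a non-empty open set $U_f\subset\mathbb{R}^n$ such that for all $y\in U_f$ we have \[\dim_T f^{-1}(y)=d^n_T(K).\] In particular, for a generic $f\in C(K,\mathbb{R}^n)$ we have \[\max\{\dim_T f^{-1}(y):y\in\mathbb{R}^n\}=d^n_T(K).\]
   Context: $\dim_T$ is the topological dimension (small inductive dimension: $\dim_T\emptyset=-1$ and $\dim_T X=\inf\{d: X$ has a basis $\mathcal{U}$ with $\dim_T\partial U\leq d-1$ for all $U\in\mathcal{U}\}$). For a separable metric space $X$ and $n\in\mathbb{N}^+$, $d^n_T(X)=\inf\{\dim_T(X\setminus F): F\subset X$ is an $F_\sigma$ set with $\dim_T F\leq n-1\}$. $C(K,\mathbb{R}^n)$ is the complete metric space of continuous maps $K\to\mathbb{R}^n$ with the maximum norm. A property holds for a generic $f\in C(K,\mathbb{R}^n)$ if the set of $f$ having it is co-meager. *)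

theory Defs
  imports "HOL-Analysis.Analysis"
begin

text \<open>The small inductive dimension takes values in \<open>{-1, 0, 1, ..., \<infinity>}\<close>; it is the extended-real
  value of the library relation \<^const>\<open>dimension_le\<close>, with \<open>Inf {} = \<infinity>\<close>.\<close>

definition small_ind_dim :: "'a topology \<Rightarrow> ereal"
  where "small_ind_dim X = Inf {ereal (of_int d) |d. X dim_le d}"

definition fsigma_codim :: "nat \<Rightarrow> 'a topology \<Rightarrow> ereal"
  where "fsigma_codim n X =
    Inf {small_ind_dim (subtopology X (topspace X - F)) |F.
           fsigma_in X F \<and> small_ind_dim (subtopology X F) \<le> ereal (real n - 1)}"

definition nowhere_dense_in :: "'a topology \<Rightarrow> 'a set \<Rightarrow> bool"
  where "nowhere_dense_in X S \<longleftrightarrow> S \<subseteq> topspace X \<and> X interior_of (X closure_of S) = {}"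

definition meager_in :: "'a topology \<Rightarrow> 'a set \<Rightarrow> bool"
  where "meager_in X = countable union_of nowhere_dense_in X"

definition generically :: "'a topology \<Rightarrow> ('a \<Rightarrow> bool) \<Rightarrow> bool"
  where "generically X P \<longleftrightarrow> meager_in X {x \<in> topspace X. \<not> P x}"

text \<open>Elements of \<^const>\<open>cfunspace\<close> are bounded (automatic on a compact domain) and take the value
  \<^const>\<open>undefined\<close> outside \<^term>\<open>mspace K\<close>, so a fibre has to be restricted to \<^term>\<open>mspace K\<close>.\<close>

abbreviation cont_space :: "'a metric \<Rightarrow> ('a \<Rightarrow> real ^ 'n) topology"
  where "cont_space K \<equiv> mtopology_of (cfunspace (mtopology_of K) euclidean_metric)"

definition fibre_dim :: "'a metric \<Rightarrow> ('a \<Rightarrow> 'b) \<Rightarrow> 'b \<Rightarrow> ereal"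
  where "fibre_dim K f y = small_ind_dim (subtopology (mtopology_of K) {x \<in> mspace K. f x = y})"

lemma small_ind_dim_le_iff: "small_ind_dim X \<le> ereal (of_int d) \<longleftrightarrow> X dim_le d"
proof
  assume "X dim_le d"
  then show "small_ind_dim X \<le> ereal (of_int d)"
    unfolding small_ind_dim_def by (intro Inf_lower) auto
next
  assume le: "small_ind_dim X \<le> ereal (of_int d)"
  show "X dim_le d"
  proof (rule ccontr)
    assume no: "\<not> X dim_le d"
    have "ereal (of_int (d + 1)) \<le> small_ind_dim X"
      unfolding small_ind_dim_def
    proof (rule Inf_greatest)
      fix v assume "v \<in> {ereal (of_int e) |e. X dim_le e}"
      then obtain e where e: "v = ereal (of_int e)" "X dim_le e" by auto
      with no have "d + 1 \<le> e" using dimension_le_mono[of X e d] by linarith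
      then show "ereal (of_int (d + 1)) \<le> v" using e by simp
    qed
    with le have "ereal (of_int (d + 1)) \<le> ereal (of_int d)" by (rule order_trans[rotated])
    then show False by simp
  qed
qed

lemma small_ind_dim_empty: "small_ind_dim (trivial_topology :: 'a topology) = ereal (-1)"
proof (rule antisym)
  show "small_ind_dim (trivial_topology :: 'a topology) \<le> ereal (-1)"
    using small_ind_dim_le_iff[of "trivial_topology :: 'a topology" "-1"] by simp
  show "ereal (-1) \<le> small_ind_dim (trivial_topology :: 'a topology)"
    unfolding small_ind_dim_def
  proof (rule Inf_greatest)
    fix v assume "v \<in> {ereal (of_int e) |e. (trivial_topology :: 'a topology) dim_le e}"
    then obtain e where "v = ereal (of_int e)" "(trivial_topology :: 'a topology) dim_le e" by blast
    then show "ereal (-1) \<le> v"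
      using dimension_le_bound[of "trivial_topology :: 'a topology" e] by simp
  qed
qed

text \<open>The defining recursion in terms of bases.\<close>

lemma small_ind_dim_le_iff_basis:
  assumes "0 \<le> d"
  shows "small_ind_dim X \<le> ereal (of_int d) \<longleftrightarrow>
    (\<exists>\<B>. openin X = arbitrary union_of (\<lambda>U. U \<in> \<B>) \<and>
         (\<forall>U\<in>\<B>. small_ind_dim (subtopology X (X frontier_of U)) \<le> ereal (of_int (d - 1))))"
    (is "_ \<longleftrightarrow> ?R")
proof -
  have "X dim_le d \<longleftrightarrow> ?R"
  proof
    assume X: "X dim_le d"
    define \<B> where "\<B> = {U. openin X U \<and> subtopology X (X frontier_of U) dim_le (d - 1)}"
    have "openin X V = (arbitrary union_of (\<lambda>U. U \<in> \<B>)) V" for V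
    proof
      assume V: "openin X V"
      have "\<forall>a\<in>V. \<exists>U\<in>\<B>. a \<in> U \<and> U \<subseteq> V"
        using X V unfolding dimension_le.simps[of X d] \<B>_def by blast
      then have "\<Union>{U \<in> \<B>. U \<subseteq> V} = V" by blast
      then show "(arbitrary union_of (\<lambda>U. U \<in> \<B>)) V"
        unfolding union_of_def arbitrary_def
        by (intro exI[of _ "{U \<in> \<B>. U \<subseteq> V}"] conjI) simp_all
    next
      assume "(arbitrary union_of (\<lambda>U. U \<in> \<B>)) V"
      then obtain \<U> where "\<U> \<subseteq> \<B>" "V = \<Union>\<U>"
        by (auto simp: union_of_def)
      then show "openin X V" by (auto simp: \<B>_def)
    qed
    then have "openin X = arbitrary union_of (\<lambda>U. U \<in> \<B>)" by (rule ext)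
    moreover have "\<forall>U\<in>\<B>. subtopology X (X frontier_of U) dim_le (d - 1)"
      by (simp add: \<B>_def)
    ultimately show ?R unfolding small_ind_dim_le_iff by (intro exI[of _ \<B>] conjI)
  next
    assume ?R
    then obtain \<B> where B: "openin X = arbitrary union_of (\<lambda>U. U \<in> \<B>)"
      and D: "\<And>U. U \<in> \<B> \<Longrightarrow> subtopology X (X frontier_of U) dim_le (d - 1)"
      unfolding small_ind_dim_le_iff by blast
    have O: "openin X U" if "U \<in> \<B>" for U
      unfolding B by (rule arbitrary_union_of_inc) (rule that)
    show "X dim_le d"
    proof (intro dimension_le.intros)
      show "- 1 \<le> d" using assms by simp
      fix V a assume "openin X V" "a \<in> V"
      then obtain \<U> where "\<U> \<subseteq> \<B>" "V = \<Union>\<U>"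
        unfolding B by (auto simp: union_of_def)
      with \<open>a \<in> V\<close> obtain U where "U \<in> \<B>" "a \<in> U" "U \<subseteq> V" by blast
      then show "\<exists>U. a \<in> U \<and> U \<subseteq> V \<and> openin X U \<and> subtopology X (X frontier_of U) dim_le d - 1"
        using O D by blast
    qed
  qed
  then show ?thesis by (simp only: small_ind_dim_le_iff)
qed

end

theory Submission
  imports Defs
begin

text \<open>
  Let \<open>m = dim K\<close>. Taking the union of the frontiers of a countable base and iterating splits off an
  F-sigma set of dimension at most \<open>n - 1\<close> whose complement has dimension at most \<open>m - n\<close>, and it turns
  out that no such set does better, so that \<open>d\<^sup>n(K) = m - n\<close>.

  The dimension theory used is read off from one fact: a closed \<open>Z\<close> has dimension less than \<open>k\<close> iff
  every map to \<open>\<real>\<^sup>k\<close> can be perturbed to have no zero on \<open>Z\<close>. If \<open>K\<close> has dimension at least \<open>m\<close>, then on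
  arbitrarily small balls there is a map \<open>h\<close> to \<open>\<real>\<^sup>m\<close> whose zero cannot be removed. Adding a small multiple of
  the first \<open>n\<close> coordinates of \<open>h\<close> to the locally almost constant \<open>f\<close> makes all nearby fibres of all nearby maps
  have dimension at least \<open>m - n\<close>: otherwise the remaining \<open>m - n\<close> coordinates could be perturbed to
  remove the zero. As a generic map misses a given value on an F-sigma set of dimension less than \<open>n\<close>, such a
  fibre can be placed in the complement of any of these sets, which gives \<open>d\<^sup>n(K) \<ge> m - n\<close>.

  For the upper bound on all fibres, induction along frontiers of a base reduces to \<open>m = n\<close>. There \<open>K\<close> is
  covered by \<open>n + 1\<close> finite families of small disjoint closed sets, and a generic \<open>f\<close> has its \<open>i\<close>-th
  coordinate separate the members of the \<open>i\<close>-th family. A fibre then meets only one member of each of \<open>n\<close>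
  families, and hence has small clopen neighbourhoods.
\<close>

subsection \<open>Category in spaces of continuous functions\<close>

text \<open>Openness and density for the uniform metric, phrased for arbitrary continuous maps so
  that later arguments need not carry \<open>extensional\<close> along. An open condition depends
  only on the values on the space, since a continuous map agreeing with \<open>f\<close> there is at
  distance 0 from it.\<close>

definition sup_open :: "'a topology \<Rightarrow> (('a \<Rightarrow> 'b::metric_space) \<Rightarrow> bool) \<Rightarrow> bool"
  where "sup_open X P \<longleftrightarrow> (\<forall>f. continuous_map X euclidean f \<and> P f \<longrightarrow>
    (\<exists>e>0. \<forall>g. continuous_map X euclidean g \<and> (\<forall>x\<in>topspace X. dist (g x) (f x) \<le> e) \<longrightarrow> P g))"

definition sup_dense :: "'a topology \<Rightarrow> (('a \<Rightarrow> 'b::metric_space) \<Rightarrow> bool) \<Rightarrow> bool"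
  where "sup_dense X P \<longleftrightarrow> (\<forall>f e. continuous_map X euclidean f \<and> 0 < e \<longrightarrow>
    (\<exists>g. continuous_map X euclidean g \<and> (\<forall>x\<in>topspace X. dist (g x) (f x) \<le> e) \<and> P g))"

lemma sup_openD:
  assumes "sup_open X P" "continuous_map X euclidean f" "P f"
  obtains e where "0 < e" "\<And>g. continuous_map X euclidean g \<Longrightarrow> (\<And>x. x \<in> topspace X \<Longrightarrow> dist (g x) (f x) \<le> e) \<Longrightarrow> P g"
proof -
  obtain e where "0 < e" "\<forall>g. continuous_map X euclidean g \<and> (\<forall>x\<in>topspace X. dist (g x) (f x) \<le> e) \<longrightarrow> P g"
    using assms unfolding sup_open_def by meson
  then show thesis by (intro that[of e]) auto
qed

lemma sup_denseD:
  assumes "sup_dense X P" "continuous_map X euclidean f" "0 < e"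
  obtains g where "continuous_map X euclidean g" "\<forall>x\<in>topspace X. dist (g x) (f x) \<le> e" "P g"
  using assms unfolding sup_dense_def by meson

declare mspace_cfunspace [simp del]

lemma in_cfunspace:
  fixes f :: "'a \<Rightarrow> 'b::metric_space"
  assumes "compact_space X"
  shows "f \<in> mspace (cfunspace X euclidean_metric) \<longleftrightarrow>
         f \<in> extensional (topspace X) \<and> continuous_map X euclidean f"
  using assms unfolding compact_space_def by (subst compactin_mspace_cfunspace) auto

lemma restrict_in_cfunspace:
  fixes f :: "'a \<Rightarrow> 'b::metric_space"
  assumes "compact_space X" "continuous_map X euclidean f"
  shows "restrict f (topspace X) \<in> mspace (cfunspace X euclidean_metric)"
  unfolding in_cfunspace[OF assms(1)] using continuous_map_eq[OF assms(2)] by simp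

lemma openin_cfunspace_sup_open:
  fixes P :: "('a \<Rightarrow> 'b::metric_space) \<Rightarrow> bool"
  assumes X: "compact_space X" and P: "sup_open X P"
  shows "openin (mtopology_of (cfunspace X euclidean_metric)) {f \<in> mspace (cfunspace X euclidean_metric). P f}"
proof -
  let ?C = "cfunspace X euclidean_metric :: ('a \<Rightarrow> 'b) metric"
  interpret C: Metric_space "mspace ?C" "mdist ?C" by simp
  have "\<exists>r>0. C.mball f r \<subseteq> {f \<in> mspace ?C. P f}" if f: "f \<in> mspace ?C" "P f" for f
  proof -
    have "continuous_map X euclidean f" using f in_cfunspace[OF X] by blast
    then obtain e where e: "e > 0" and eP: "\<And>g. continuous_map X euclidean g \<Longrightarrow> (\<And>x. x \<in> topspace X \<Longrightarrow> dist (g x) (f x) \<le> e) \<Longrightarrow> P g"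
      using sup_openD[OF P] f by metis
    have "C.mball f e \<subseteq> {f \<in> mspace ?C. P f}"
    proof
      fix g assume g: "g \<in> C.mball f e"
      then have gC: "g \<in> mspace ?C" and d: "mdist ?C g f \<le> e" using C.commute by auto
      have "continuous_map X euclidean g" using gC in_cfunspace[OF X] by blast
      moreover have "dist (g x) (f x) \<le> e" if "x \<in> topspace X" for x
        using mdist_cfunspace_imp_mdist_le[OF gC f(1) d that] by simp
      ultimately show "g \<in> {f \<in> mspace ?C. P f}" using eP gC by blast
    qed
    then show ?thesis using e by blast
  qed
  then show ?thesis
    unfolding mtopology_of_def C.openin_mtopology by blast
qed

lemma closure_cfunspace_sup_dense:
  fixes P :: "('a \<Rightarrow> 'b::metric_space) \<Rightarrow> bool"
  assumes X: "compact_space X" and P: "sup_dense X P" "sup_open X P"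
  shows "mtopology_of (cfunspace X euclidean_metric) closure_of {f \<in> mspace (cfunspace X euclidean_metric). P f}
       = mspace (cfunspace X euclidean_metric)"
proof -
  let ?C = "cfunspace X euclidean_metric :: ('a \<Rightarrow> 'b) metric"
  interpret C: Metric_space "mspace ?C" "mdist ?C" by simp
  have "\<exists>g\<in>{f \<in> mspace ?C. P f}. g \<in> C.mball f r" if f: "f \<in> mspace ?C" and r: "r > 0" for f r
  proof -
    have fc: "continuous_map X euclidean f" using f in_cfunspace[OF X] by blast
    have r2: "0 < r/2" using r by simp
    obtain g where g: "continuous_map X euclidean g" "\<forall>x\<in>topspace X. dist (g x) (f x) \<le> r/2" "P g"
      by (rule sup_denseD[OF P(1) fc r2])
    let ?g = "restrict g (topspace X)"
    obtain e where e: "e > 0" and eP: "\<And>h. continuous_map X euclidean h \<Longrightarrow> (\<And>x. x \<in> topspace X \<Longrightarrow> dist (h x) (g x) \<le> e) \<Longrightarrow> P h"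
      using sup_openD[OF P(2) g(1,3)] by metis
    have gC: "?g \<in> mspace ?C" by (rule restrict_in_cfunspace[OF X g(1)])
    \<comment> \<open>The restriction agrees with \<open>g\<close> on the space, so openness of
      \<open>P\<close> transfers the condition to it.\<close>
    have "P ?g"
      using eP[of ?g] gC in_cfunspace[OF X] e g(1) by simp
    moreover have "mdist ?C f ?g \<le> r/2"
      by (rule mdist_cfunspace_le) (use r g(2) in \<open>auto simp: dist_commute\<close>)
    ultimately show ?thesis using gC f r by auto
  qed
  then show ?thesis
    unfolding mtopology_of_def C.metric_closure_of by auto
qed

text \<open>Baire's theorem in \<open>cfunspace\<close>, which is complete because the target is,
  carried back to maps that need not be extensional. It supplies small perturbations that satisfy
  countably many conditions at once.\<close>

lemma sup_dense_Inter:
  fixes P :: "'i \<Rightarrow> ('a \<Rightarrow> 'b::complete_space) \<Rightarrow> bool"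
  assumes X: "compact_space X" and I: "countable I"
    and P: "\<And>i. i \<in> I \<Longrightarrow> sup_open X (P i)" "\<And>i. i \<in> I \<Longrightarrow> sup_dense X (P i)"
  shows "sup_dense X (\<lambda>f. \<forall>i\<in>I. P i f)"
  unfolding sup_dense_def
proof (intro allI impI, elim conjE)
  fix f :: "'a \<Rightarrow> 'b" and e :: real assume f: "continuous_map X euclidean f" and e: "0 < e"
  let ?C = "cfunspace X euclidean_metric :: ('a \<Rightarrow> 'b) metric"
  interpret C: Metric_space "mspace ?C" "mdist ?C" by simp
  have "mcomplete_of ?C"
    unfolding euclidean_metric_def
    using Met_TC.mcomplete_cfunspace[where X=X and 'a='b] complete_UNIV by (auto simp: Met_TC.Self_def)
  then have "C.mcomplete" by (simp add: mcomplete_of_def)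
  then have "C.mtopology closure_of \<Inter>((\<lambda>i. {f \<in> mspace ?C. P i f}) ` I) = mspace ?C"
    by (rule C.metric_Baire_category)
      (use I openin_cfunspace_sup_open[OF X P(1)] closure_cfunspace_sup_dense[OF X P(2) P(1)] in \<open>auto simp: mtopology_of_def\<close>)
  moreover have rf: "restrict f (topspace X) \<in> mspace ?C" by (rule restrict_in_cfunspace[OF X f])
  ultimately obtain g where g: "g \<in> \<Inter>((\<lambda>i. {f \<in> mspace ?C. P i f}) ` I)" "g \<in> C.mball (restrict f (topspace X)) e"
    using e unfolding C.metric_closure_of by blast
  have gC: "g \<in> mspace ?C" and d: "mdist ?C g (restrict f (topspace X)) \<le> e" using g(2) C.commute by auto
  show "\<exists>g. continuous_map X euclidean g \<and> (\<forall>x\<in>topspace X. dist (g x) (f x) \<le> e) \<and> (\<forall>i\<in>I. P i g)"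
    using mdist_cfunspace_imp_mdist_le[OF gC rf d] gC in_cfunspace[OF X] g(1)
    by (intro exI[of _ g]) auto
qed

text \<open>Each failure set is closed with empty interior, and a map for which \<open>Q\<close>
  fails lies in one of countably many of them.\<close>

lemma generically_countable:
  fixes P :: "'i \<Rightarrow> ('a \<Rightarrow> real ^ 'n) \<Rightarrow> bool"
  assumes X: "compact_space (mtopology_of K)" and I: "countable I"
    and P: "\<And>i. i \<in> I \<Longrightarrow> sup_open (mtopology_of K) (P i)" "\<And>i. i \<in> I \<Longrightarrow> sup_dense (mtopology_of K) (P i)"
    and Q: "\<And>f. continuous_map (mtopology_of K) euclidean f \<Longrightarrow> (\<And>i. i \<in> I \<Longrightarrow> P i f) \<Longrightarrow> Q f"
  shows "generically (cont_space K) Q"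
proof -
  let ?T = "cont_space K :: ('a \<Rightarrow> real ^ 'n) topology"
  let ?N = "\<lambda>i. {f \<in> topspace ?T. \<not> P i f}"
  have nd: "nowhere_dense_in ?T A" if "A \<subseteq> ?N i" "i \<in> I" for i A
  proof -
    have N: "?N i = topspace ?T - {f \<in> topspace ?T. P i f}" by auto
    have op: "openin ?T {f \<in> topspace ?T. P i f}"
      using openin_cfunspace_sup_open[OF X P(1)] that by simp
    have "closedin ?T (?N i)" unfolding N using op by blast
    then have "?T closure_of A \<subseteq> ?N i" using that closure_of_minimal by blast
    moreover have "?T interior_of (?N i) = {}"
      unfolding N interior_of_complement
      using closure_cfunspace_sup_dense[OF X P(2) P(1)] that by simp
    ultimately have "?T interior_of (?T closure_of A) = {}" using interior_of_mono by blast
    then show ?thesis using that unfolding nowhere_dense_in_def by auto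
  qed
  let ?B = "{f \<in> topspace ?T. \<not> Q f}"
  \<comment> \<open>\<open>meager_in\<close> asks for an exact union, so every failure set is cut
    down to \<open>?B\<close>.\<close>
  have "?B = \<Union>((\<lambda>i. ?N i \<inter> ?B) ` I)"
    using Q in_cfunspace[OF X] by fastforce
  then have "meager_in ?T ?B"
    unfolding meager_in_def union_of_def
    by (intro exI[of _ "(\<lambda>i. ?N i \<inter> ?B) ` I"]) (use I nd[OF Int_lower1] in auto)
  then show ?thesis unfolding generically_def .
qed

text \<open>Perturbing \<open>f\<close> to \<open>nudge e f g\<close> replaces Tietze extension: \<open>g\<close> is defined everywhere
  but only has to be close to \<open>f\<close> on the set that matters.\<close>

definition nudge :: "real \<Rightarrow> real \<Rightarrow> real \<Rightarrow> real"
  where "nudge e a b = max (a - e) (min (a + e) b)"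

lemma nudge_close: "0 \<le> e \<Longrightarrow> \<bar>nudge e a b - a\<bar> \<le> e"
  by (auto simp: nudge_def)

lemma nudge_eq: "\<bar>b - a\<bar> \<le> e \<Longrightarrow> nudge e a b = b"
  by (auto simp: nudge_def)

text \<open>The clamp of \<open>b\<close> to the interval from \<open>a - e\<close> to
  \<open>a + e\<close> can create a new zero only if 0 is an endpoint, that is if \<open>a\<close>
  is \<open>e\<close> or \<open>- e\<close>; the sign conditions exclude this.\<close>

lemma nudge_eq_0:
  assumes "nudge e a b = 0" "0 < e" "a \<ge> e \<Longrightarrow> b > 0" "a \<le> - e \<Longrightarrow> b < 0"
  shows "b = 0"
  using assms by (auto simp: nudge_def max_def min_def split: if_splits)

lemma continuous_map_nudge:
  assumes "continuous_map X euclideanreal f" "continuous_map X euclideanreal g"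
  shows "continuous_map X euclideanreal (\<lambda>x. nudge e (f x) (g x))"
  unfolding nudge_def by (intro continuous_intros assms) (auto intro: assms)

subsection \<open>Dimension of closed subsets of a compact metric space\<close>

lemma dim_leE:
  assumes "Y dim_le d" "openin Y V" "a \<in> V"
  obtains U where "a \<in> U" "U \<subseteq> V" "openin Y U" "subtopology Y (Y frontier_of U) dim_le (d - 1)"
  using assms(1)
proof cases
  case 1
  from 1(2)[OF assms(2,3)] show thesis using that by (elim exE conjE)
qed

locale compact_metric =
  fixes K :: "'a metric"
  assumes compact: "compact_space (mtopology_of K)"
begin

sublocale Metric_space "mspace K" "mdist K"
  by simp

abbreviation X :: "'a topology" where "X \<equiv> mtopology_of K"

lemma mtopology_eq [simp]: "mtopology = X"
  by (simp add: mtopology_of_def)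

lemma normal: "normal_space X"
  using normal_space_mtopology by simp

lemma t1: "t1_space X"
  using t1_space_mtopology by simp

lemma closedin_imp_compactin: "closedin X S \<Longrightarrow> compactin X S"
  by (rule closedin_compact_space[OF compact])

section \<open>Compactness, countable bases and distance functions\<close>

lemma uniformly_continuous:
  assumes "continuous_map X euclidean f" "0 < e"
  obtains d where "0 < d"
    "\<And>x y. x \<in> mspace K \<Longrightarrow> y \<in> mspace K \<Longrightarrow> mdist K x y < d \<Longrightarrow> dist (f x) (f y) < e"
proof -
  have "uniformly_continuous_map K euclidean_metric f"
    using continuous_imp_uniformly_continuous_map[of K euclidean_metric f] compact assms by simp
  then obtain d where "0 < d" "\<forall>x\<in>mspace K. \<forall>y\<in>mspace K. mdist K y x < d \<longrightarrow> dist (f y) (f x) < e"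
    unfolding uniformly_continuous_map_def using assms(2) by auto
  then show thesis by (intro that[of d]) auto
qed

lemma second_countable_compact_metric: "second_countable X"
proof -
  have "mtotally_bounded (mspace K)"
    using compact compactin_imp_mtotally_bounded[of "mspace K"] by (simp add: compact_space_def)
  then have "\<exists>C. finite C \<and> C \<subseteq> mspace K \<and> mspace K \<subseteq> (\<Union>x\<in>C. mball x (inverse (Suc n)))" for n
    unfolding mtotally_bounded_def by (metis inverse_Suc)
  then obtain C where C: "\<And>n. finite (C n)" "\<And>n. C n \<subseteq> mspace K"
      "\<And>n. mspace K \<subseteq> (\<Union>x\<in>C n. mball x (inverse (Suc n)))"
    by metis
  define B where "B = (\<Union>n. (\<lambda>x. mball x (inverse (Suc n))) ` C n)"
  have "\<exists>V\<in>B. x \<in> V \<and> V \<subseteq> U" if U: "openin X U" "x \<in> U" for U x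
  proof -
    obtain r where r: "0 < r" "mball x r \<subseteq> U"
      using U openin_mtopology by auto
    obtain n where n: "inverse (Suc n) < r/2"
      using reals_Archimedean[of "r/2"] r by auto
    have x: "x \<in> mspace K" using U openin_subset by fastforce
    then obtain c where c: "c \<in> C n" "x \<in> mball c (inverse (Suc n))" using C(3) by blast
    have "mball c (inverse (Suc n)) \<subseteq> mball x r"
      by (rule mball_subset) (use c n x commute[of x c] in auto)
    then show ?thesis using c r unfolding B_def by blast
  qed
  moreover have "countable B" unfolding B_def using C(1) by (intro countable_UN) (auto intro: countable_finite)
  moreover have "\<forall>V\<in>B. openin X V" unfolding B_def using openin_mball by auto
  ultimately show ?thesis unfolding second_countable_def by blast
qed

text \<open>The witness is the distance to \<open>C\<close>, which is 1-Lipschitz. For empty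
  \<open>C\<close> that infimum carries no information, and the constant 1 is used instead.\<close>

lemma closedin_zero_set:
  assumes "closedin X C"
  obtains \<phi> where "continuous_map X euclideanreal \<phi>" "\<And>x. x \<in> topspace X \<Longrightarrow> 0 \<le> \<phi> x"
    "\<And>x. x \<in> topspace X \<Longrightarrow> \<phi> x = 0 \<longleftrightarrow> x \<in> C"
proof (cases "C = {}")
  case True
  then show ?thesis by (intro that[of "\<lambda>_. 1"]) auto
next
  case False
  define \<phi> where "\<phi> x = (INF c\<in>C. mdist K x c)" for x
  have CK: "C \<subseteq> mspace K" using assms closedin_subset by fastforce
  have bdd: "bdd_below ((\<lambda>c. mdist K x c) ` C)" for x by (rule bdd_belowI[of _ 0]) auto
  have le: "\<phi> x \<le> mdist K x c" if "c \<in> C" for x c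
    unfolding \<phi>_def by (rule cINF_lower[OF bdd that])
  have nn: "0 \<le> \<phi> x" for x unfolding \<phi>_def by (rule cINF_greatest[OF False]) simp
  have tri: "\<phi> x \<le> mdist K x y + \<phi> y" if "x \<in> mspace K" "y \<in> mspace K" for x y
  proof -
    have "\<phi> x - mdist K x y \<le> \<phi> y"
      unfolding \<phi>_def[of y]
    proof (rule cINF_greatest[OF False])
      fix c assume "c \<in> C"
      then have "\<phi> x \<le> mdist K x y + mdist K y c"
        using le[of c x] mdist_triangle[of x K y c] that CK by fastforce
      then show "\<phi> x - mdist K x y \<le> mdist K y c" by simp
    qed
    then show ?thesis by simp
  qed
  have "Lipschitz_continuous_map K euclidean_metric \<phi>"
    unfolding Lipschitz_continuous_map_def
  proof (intro conjI exI[of _ 1] ballI)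
    fix x y assume "x \<in> mspace K" "y \<in> mspace K"
    then show "mdist euclidean_metric (\<phi> x) (\<phi> y) \<le> 1 * mdist K x y"
      using tri[of x y] tri[of y x] commute[of x y] by (simp add: dist_real_def)
  qed simp
  then have "continuous_map X euclideanreal \<phi>"
    using Lipschitz_continuous_imp_continuous_map by fastforce
  moreover have "\<phi> x = 0 \<longleftrightarrow> x \<in> C" if "x \<in> topspace X" for x
  proof
    assume "x \<in> C"
    then show "\<phi> x = 0" using le[of x x] nn[of x] CK by (simp add: subset_iff)
  next
    assume z: "\<phi> x = 0"
    have "\<exists>c\<in>C. c \<in> mball x r" if "r > 0" for r
    proof (rule ccontr)
      assume n: "\<not> (\<exists>c\<in>C. c \<in> mball x r)"
      have "r \<le> \<phi> x"
        unfolding \<phi>_def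
        by (rule cINF_greatest[OF False]) (use n \<open>x \<in> topspace X\<close> CK in force)
      then show False using z that by simp
    qed
    then have "x \<in> X closure_of C"
      using that metric_closure_of[of C] by simp
    then show "x \<in> C" using assms closure_of_closedin by blast
  qed
  ultimately show ?thesis using nn by (intro that) auto
qed

text \<open>The sum of the absolute values attains a positive minimum on the compact set
  \<open>Z\<close>, and at every point some summand is at least the average. The bound makes the
  absence of zeros stable under small perturbations.\<close>

lemma nonvanishing_bound:
  fixes k :: nat
  assumes Z: "closedin X Z" and f: "\<And>i. i < k \<Longrightarrow> continuous_map X euclideanreal (f i)"
    and nz: "\<And>x. x \<in> Z \<Longrightarrow> \<exists>i<k. f i x \<noteq> 0"
  obtains c where "0 < c" "\<forall>x\<in>Z. \<exists>i<k. c \<le> \<bar>f i x\<bar>"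
proof (cases "Z = {}")
  case True
  then show ?thesis by (intro that[of 1]) auto
next
  case False
  define \<phi> where "\<phi> x = (\<Sum>i<k. \<bar>f i x\<bar>)" for x
  have "continuous_map X euclideanreal \<phi>"
    unfolding \<phi>_def by (intro continuous_map_sum continuous_map_real_abs f) auto
  then have "compact (\<phi> ` Z)"
    using image_compactin[OF closedin_imp_compactin[OF Z]] by fastforce
  then obtain z where z: "z \<in> Z" "\<And>x. x \<in> Z \<Longrightarrow> \<phi> z \<le> \<phi> x"
    using compact_attains_inf[of "\<phi> ` Z"] False by auto
  obtain i where i: "i < k" "f i z \<noteq> 0" using nz[OF z(1)] by blast
  have "\<bar>f i z\<bar> \<le> \<phi> z" unfolding \<phi>_def by (rule member_le_sum) (use i in auto)
  then have pos: "0 < \<phi> z" using i by simp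
  show thesis
  \<comment> \<open>Dividing by \<open>k + 1\<close> rather than \<open>k\<close> turns the
    non-strict estimate of \<open>sum_bounded_above\<close> into a strict contradiction with the
    minimum.\<close>
  proof (rule that[of "\<phi> z / (real k + 1)"])
    show "0 < \<phi> z / (real k + 1)" using pos by simp
    show "\<forall>x\<in>Z. \<exists>i<k. \<phi> z / (real k + 1) \<le> \<bar>f i x\<bar>"
    proof (rule ballI, rule ccontr)
      fix x assume x: "x \<in> Z"
      assume "\<not> (\<exists>i<k. \<phi> z / (real k + 1) \<le> \<bar>f i x\<bar>)"
      then have "\<And>i. i \<in> {..<k} \<Longrightarrow> \<bar>f i x\<bar> \<le> \<phi> z / (real k + 1)" by force
      then have "\<phi> x \<le> real (card {..<k}) * (\<phi> z / (real k + 1))"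
        unfolding \<phi>_def by (rule sum_bounded_above)
      also have "\<dots> < \<phi> z" using pos by (simp add: field_simps)
      finally show False using z(2)[OF x] by simp
    qed
  qed
qed

text \<open>Hurewicz--Wallman's condition of unstable values: for closed \<open>Z\<close> it is equivalent to
  \<open>dim Z \<le> k - 1\<close>. Stating it for maps on all of \<open>X\<close> makes monotonicity in \<open>Z\<close> trivial.\<close>

definition avoidable :: "nat \<Rightarrow> 'a set \<Rightarrow> bool"
  where "avoidable k Z \<longleftrightarrow>
    (\<forall>f e. (\<forall>i<k. continuous_map X euclideanreal (f i)) \<and> 0 < e \<longrightarrow>
      (\<exists>g. (\<forall>i<k. continuous_map X euclideanreal (g i) \<and> (\<forall>x\<in>topspace X. \<bar>g i x - f i x\<bar> \<le> e)) \<and>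
           (\<forall>x\<in>Z. \<exists>i<k. g i x \<noteq> 0)))"

lemma avoidableD:
  assumes "avoidable k Z" "\<And>i. i < k \<Longrightarrow> continuous_map X euclideanreal (f i)" "0 < e"
  obtains g where "\<forall>i<k. continuous_map X euclideanreal (g i)"
    "\<forall>i<k. \<forall>x\<in>topspace X. \<bar>g i x - f i x\<bar> \<le> e"
    "\<forall>x\<in>Z. \<exists>i<k. g i x \<noteq> 0"
proof -
  have "(\<forall>i<k. continuous_map X euclideanreal (f i)) \<and> 0 < e" using assms by simp
  from assms(1)[unfolded avoidable_def, rule_format, OF this]
  obtain g where g: "\<forall>i<k. continuous_map X euclideanreal (g i) \<and> (\<forall>x\<in>topspace X. \<bar>g i x - f i x\<bar> \<le> e)"
      "\<forall>x\<in>Z. \<exists>i<k. g i x \<noteq> 0"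
    by (elim exE conjE)
  show thesis by (rule that[of g]) (use g in auto)
qed

lemma avoidableI:
  assumes "\<And>f e. (\<And>i. i < k \<Longrightarrow> continuous_map X euclideanreal (f i)) \<Longrightarrow> 0 < e \<Longrightarrow>
      \<exists>g. (\<forall>i<k. continuous_map X euclideanreal (g i) \<and> (\<forall>x\<in>topspace X. \<bar>g i x - f i x\<bar> \<le> e)) \<and>
           (\<forall>x\<in>Z. \<exists>i<k. g i x \<noteq> 0)"
  shows "avoidable k Z"
  unfolding avoidable_def by (intro allI impI assms) auto

lemma avoidable_mono:
  assumes "avoidable k Z" "Y \<subseteq> Z"
  shows "avoidable k Y"
proof (rule avoidableI)
  fix f :: "nat \<Rightarrow> 'a \<Rightarrow> real" and e :: real
  assume f: "\<And>i. i < k \<Longrightarrow> continuous_map X euclideanreal (f i)" and e: "0 < e"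
  obtain g where "\<forall>i<k. continuous_map X euclideanreal (g i)"
    "\<forall>i<k. \<forall>x\<in>topspace X. \<bar>g i x - f i x\<bar> \<le> e"
    "\<forall>x\<in>Z. \<exists>i<k. g i x \<noteq> 0"
    by (rule avoidableD[OF assms(1) f e])
  note g = this[rule_format]
  show "\<exists>g. (\<forall>i<k. continuous_map X euclideanreal (g i) \<and> (\<forall>x\<in>topspace X. \<bar>g i x - f i x\<bar> \<le> e)) \<and>
           (\<forall>x\<in>Y. \<exists>i<k. g i x \<noteq> 0)"
    using g assms(2) by (intro exI[of _ g]) (simp add: subset_iff)
qed

lemma avoidable_empty [simp]: "avoidable k {}"
proof (rule avoidableI)
  fix f :: "nat \<Rightarrow> 'a \<Rightarrow> real" and e :: real
  assume "\<And>i. i < k \<Longrightarrow> continuous_map X euclideanreal (f i)" "0 < e"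
  then show "\<exists>g. (\<forall>i<k. continuous_map X euclideanreal (g i) \<and> (\<forall>x\<in>topspace X. \<bar>g i x - f i x\<bar> \<le> e)) \<and>
           (\<forall>x\<in>{}. \<exists>i<k. g i x \<noteq> 0)"
    by (intro exI[of _ f]) auto
qed

text \<open>With no coordinates no point can be a non-zero, which matches dimension -1 and starts
  the inductions on \<open>k\<close>.\<close>

lemma avoidable_0_iff [simp]: "avoidable 0 Z \<longleftrightarrow> Z = {}"
proof
  assume "avoidable 0 Z"
  then show "Z = {}" by (rule avoidableD[where f="\<lambda>_ _. 0" and e=1]) auto
qed simp

text \<open>First remove the zeros on \<open>Y\<close>. By compactness the new map then keeps a
  distance \<open>c\<close> from 0 on \<open>Y\<close>, so a second perturbation below
  \<open>c\<close>, made for \<open>Z\<close>, does not bring them back.\<close>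

lemma avoidable_Un:
  assumes "avoidable k Y" "avoidable k Z" "closedin X Y"
  shows "avoidable k (Y \<union> Z)"
proof (rule avoidableI)
  fix f :: "nat \<Rightarrow> 'a \<Rightarrow> real" and e :: real
  assume f: "\<And>i. i < k \<Longrightarrow> continuous_map X euclideanreal (f i)" and e: "0 < e"
  have e2: "0 < e/2" using e by simp
  obtain g where "\<forall>i<k. continuous_map X euclideanreal (g i)"
    "\<forall>i<k. \<forall>x\<in>topspace X. \<bar>g i x - f i x\<bar> \<le> e/2"
    "\<forall>x\<in>Y. \<exists>i<k. g i x \<noteq> 0"
    by (rule avoidableD[OF assms(1) f e2])
  note g = this[rule_format]
  obtain c where "0 < c" "\<forall>x\<in>Y. \<exists>i<k. c \<le> \<bar>g i x\<bar>"
    by (rule nonvanishing_bound[OF assms(3) g(1,3)])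
  note c = this[rule_format]
  have m: "0 < min (e/2) (c/2)" using e c by simp
  obtain h where "\<forall>i<k. continuous_map X euclideanreal (h i)"
    "\<forall>i<k. \<forall>x\<in>topspace X. \<bar>h i x - g i x\<bar> \<le> min (e/2) (c/2)"
    "\<forall>x\<in>Z. \<exists>i<k. h i x \<noteq> 0"
    by (rule avoidableD[OF assms(2) g(1) m])
  note h = this[rule_format]
  show "\<exists>g. (\<forall>i<k. continuous_map X euclideanreal (g i) \<and> (\<forall>x\<in>topspace X. \<bar>g i x - f i x\<bar> \<le> e)) \<and>
           (\<forall>x\<in>Y \<union> Z. \<exists>i<k. g i x \<noteq> 0)"
  proof (intro exI[of _ h] conjI allI impI ballI h(1))
    show "\<bar>h i x - f i x\<bar> \<le> e" if "i < k" "x \<in> topspace X" for i x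
      using h(2)[OF that] g(2)[OF that] by linarith
    fix x assume "x \<in> Y \<union> Z"
    moreover have "\<exists>i<k. h i x \<noteq> 0" if x: "x \<in> Y"
    proof -
      obtain i where i: "i < k" "c \<le> \<bar>g i x\<bar>" using c(2)[OF x] by blast
      have "x \<in> topspace X" using x assms(3) closedin_subset by blast
      then have "h i x \<noteq> 0" using h(2)[OF i(1)] i(2) c(1) by fastforce
      then show ?thesis using i by blast
    qed
    ultimately show "\<exists>i<k. h i x \<noteq> 0" using h(3) by blast
  qed
qed

lemma avoidable_UN:
  assumes "finite I" "\<And>i. i \<in> I \<Longrightarrow> closedin X (Z i)" "\<And>i. i \<in> I \<Longrightarrow> avoidable k (Z i)"
  shows "avoidable k (\<Union>i\<in>I. Z i)"
  using assms by (induction I rule: finite_induct) (auto intro: avoidable_Un)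

section \<open>Small inductive dimension makes zeros removable\<close>

text \<open>Induction on the number of coordinates. A relatively open \<open>W\<close> in
  \<open>Z\<close> is squeezed between \<open>f 0 \<le> - e\<close> and \<open>f 0 < 0\<close>, with
  a frontier \<open>L\<close> of lower dimension. The other coordinates are perturbed to have no
  common zero on \<open>L\<close>, and \<open>f 0\<close> is changed by at most \<open>e\<close> so
  that its zeros in \<open>Z\<close> lie in \<open>L\<close>.\<close>

lemma dim_le_imp_avoidable:
  "closedin X Z \<Longrightarrow> subtopology X Z dim_le (int k - 1) \<Longrightarrow> avoidable k Z"
proof (induction k arbitrary: Z)
  case 0
  have "subtopology X Z = trivial_topology" using 0(2) by simp
  then have "topspace (subtopology X Z) = {}" by (simp only: topspace_discrete_topology)
  then show ?case using closedin_subset[OF 0(1)] by auto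
next
  case (Suc k)
  define Y where "Y = subtopology X Z"
  have ZX: "Z \<subseteq> topspace X" using Suc.prems(1) closedin_subset by blast
  have tY: "topspace Y = Z" unfolding Y_def using ZX by auto
  show ?case
  proof (rule avoidableI)
    fix f :: "nat \<Rightarrow> 'a \<Rightarrow> real" and e :: real
    assume f: "\<And>i. i < Suc k \<Longrightarrow> continuous_map X euclideanreal (f i)" and e: "0 < e"
    have f0: "continuous_map Y euclideanreal (f 0)"
      unfolding Y_def using f[of 0] by (simp add: continuous_map_from_subtopology)
    \<comment> \<open>\<open>A\<close> is compact, so finitely many open sets with small frontier
      cover it; all are taken inside \<open>N\<close>, and \<open>W\<close> is their union.\<close>
    define A where "A = {x\<in>Z. f 0 x \<le> - e}"
    define N where "N = {x\<in>Z. f 0 x < 0}"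
    have A_eq: "A = {x \<in> topspace Y. f 0 x \<in> {..-e}}" and N_eq: "N = {x \<in> topspace Y. f 0 x \<in> {..<0}}"
      unfolding A_def N_def tY by auto
    have "closedin Y A" unfolding A_eq by (rule closedin_continuous_map_preimage[OF f0]) auto
    then have "closedin X A" unfolding Y_def using Suc.prems(1) closedin_trans_full by blast
    then have "compactin Y A"
      unfolding Y_def by (simp add: closedin_imp_compactin compactin_subtopology A_def)
    moreover have oN: "openin Y N" unfolding N_eq by (rule openin_continuous_map_preimage[OF f0]) auto
    define \<U> where "\<U> = {U. U \<subseteq> N \<and> openin Y U \<and> subtopology Y (Y frontier_of U) dim_le (int k - 1)}"
    have "A \<subseteq> \<Union>\<U>"
    proof
      fix a assume "a \<in> A"
      then have "a \<in> N" using e unfolding A_def N_def by auto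
      have "Y dim_le int (Suc k) - 1" using Suc.prems(2) by (simp only: Y_def)
      then obtain U where "a \<in> U" "U \<subseteq> N" "openin Y U"
          "subtopology Y (Y frontier_of U) dim_le (int (Suc k) - 1 - 1)"
        using oN \<open>a \<in> N\<close> by (rule dim_leE)
      then have "U \<in> \<U>" by (simp add: \<U>_def)
      then show "a \<in> \<Union>\<U>" using \<open>a \<in> U\<close> by blast
    qed
    ultimately obtain \<F> where F: "finite \<F>" "\<F> \<subseteq> \<U>" "A \<subseteq> \<Union>\<F>"
      using compactinD[of Y A \<U>] unfolding \<U>_def by blast
    define W where "W = \<Union>\<F>"
    define L where "L = Y frontier_of W"
    have oW: "openin Y W" unfolding W_def using F(2) by (auto simp: \<U>_def)
    have WN: "W \<subseteq> N" unfolding W_def using F(2) by (auto simp: \<U>_def)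
    have "avoidable k (\<Union>U\<in>\<F>. Y frontier_of U)"
    proof (rule avoidable_UN[OF F(1)])
      fix U assume U: "U \<in> \<F>"
      show c: "closedin X (Y frontier_of U)"
        using closedin_trans_full[OF closedin_frontier_of[of Y U, unfolded Y_def] Suc.prems(1)] unfolding Y_def .
      show "avoidable k (Y frontier_of U)"
      proof (rule Suc.IH[OF c])
        have "Y frontier_of U \<subseteq> Z" using frontier_of_subset_topspace[of Y U] tY by simp
        moreover have "subtopology Y (Y frontier_of U) dim_le (int k - 1)" using U F(2) \<U>_def by blast
        ultimately show "subtopology X (Y frontier_of U) dim_le (int k - 1)"
          unfolding Y_def by (simp add: subtopology_subtopology Int_absorb1)
      qed
    qed
    then have L: "avoidable k L"
      unfolding L_def W_def by (rule avoidable_mono) (rule frontier_of_Union_subset[OF F(1)])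
    have fS: "\<And>i. i < k \<Longrightarrow> continuous_map X euclideanreal (f (Suc i))" using f by simp
    obtain h where "\<forall>i<k. continuous_map X euclideanreal (h i)"
      "\<forall>i<k. \<forall>x\<in>topspace X. \<bar>h i x - f (Suc i) x\<bar> \<le> e"
      "\<forall>x\<in>L. \<exists>i<k. h i x \<noteq> 0"
      by (rule avoidableD[OF L fS e])
    note h = this[rule_format]
    define C where "C = Y closure_of W"
    have "closedin X C" unfolding C_def
      using closedin_trans_full[OF closedin_closure_of[of Y W, unfolded Y_def] Suc.prems(1)] unfolding Y_def .
    then obtain \<phi> where \<phi>: "continuous_map X euclideanreal \<phi>" "\<And>x. x \<in> topspace X \<Longrightarrow> 0 \<le> \<phi> x"
      "\<And>x. x \<in> topspace X \<Longrightarrow> \<phi> x = 0 \<longleftrightarrow> x \<in> C" using closedin_zero_set by blast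
    have "closedin Y (Z - W)" using oW tY by blast
    then have "closedin X (Z - W)" unfolding Y_def using Suc.prems(1) closedin_trans_full by blast
    then obtain \<psi> where \<psi>: "continuous_map X euclideanreal \<psi>" "\<And>x. x \<in> topspace X \<Longrightarrow> 0 \<le> \<psi> x"
      "\<And>x. x \<in> topspace X \<Longrightarrow> \<psi> x = 0 \<longleftrightarrow> x \<in> Z - W" using closedin_zero_set by blast
    have CW: "W \<subseteq> C" "C - W = L"
      unfolding C_def L_def using closure_of_subset[OF openin_subset[OF oW]] frontier_of_openin[OF oW] by auto
    have "closedin Y {x \<in> topspace Y. f 0 x \<in> {..0}}" by (rule closedin_continuous_map_preimage[OF f0]) auto
    \<comment> \<open>Hence points with \<open>f 0 x \<ge> e\<close> lie outside the closure of
      \<open>W\<close>, where \<open>s\<close> will be positive.\<close>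
    then have C0: "C \<subseteq> {x \<in> topspace Y. f 0 x \<in> {..0}}"
      unfolding C_def by (rule closure_of_minimal[rotated]) (use WN N_eq in auto)
    \<comment> \<open>On \<open>Z\<close> this is negative in \<open>W\<close>, positive outside
      \<open>C\<close> and zero exactly on \<open>L\<close>: it has the signs that
      \<open>nudge_eq_0\<close> needs.\<close>
    define s where "s x = \<phi> x - \<psi> x" for x
    have s_cont: "continuous_map X euclideanreal s"
      unfolding s_def by (intro continuous_map_diff \<phi> \<psi>)
    define g where "g i = (case i of 0 \<Rightarrow> (\<lambda>x. nudge e (f 0 x) (s x)) | Suc j \<Rightarrow> h j)" for i
    show "\<exists>g. (\<forall>i<Suc k. continuous_map X euclideanreal (g i) \<and> (\<forall>x\<in>topspace X. \<bar>g i x - f i x\<bar> \<le> e)) \<and>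
           (\<forall>x\<in>Z. \<exists>i<Suc k. g i x \<noteq> 0)"
    proof (intro exI[of _ g] conjI allI impI ballI)
      show "continuous_map X euclideanreal (g i)" if "i < Suc k" for i
        using that f[of 0] h(1) s_cont by (cases i) (auto simp: g_def intro!: continuous_map_nudge)
      show "\<bar>g i x - f i x\<bar> \<le> e" if "i < Suc k" "x \<in> topspace X" for i x
        using that h(2) e by (cases i) (auto simp: g_def intro!: nudge_close)
      fix x assume x: "x \<in> Z"
      then have xX: "x \<in> topspace X" using ZX by blast
      show "\<exists>i<Suc k. g i x \<noteq> 0"
      proof (cases "g 0 x = 0")
        case True
        have "s x = 0"
        proof (rule nudge_eq_0)
          show "nudge e (f 0 x) (s x) = 0" using True by (simp add: g_def)
          show "0 < s x" if "e \<le> f 0 x"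
          proof -
            have "x \<notin> C" using C0 that e by auto
            then have "0 < \<phi> x" "\<psi> x = 0" using \<phi>(2,3)[OF xX] \<psi>(3)[OF xX] x CW(1) by fastforce+
            then show ?thesis by (simp add: s_def)
          qed
          show "s x < 0" if "f 0 x \<le> - e"
          proof -
            have "x \<in> W" using F(3) that x unfolding W_def A_def by auto
            then have "\<phi> x = 0" "0 < \<psi> x" using \<phi>(3)[OF xX] \<psi>(2,3)[OF xX] CW(1) by fastforce+
            then show ?thesis by (simp add: s_def)
          qed
        qed (rule e)
        have "x \<in> L"
        proof (cases "x \<in> W")
          case True
          then have "\<phi> x = 0" "\<psi> x \<noteq> 0" using \<phi>(3)[OF xX] \<psi>(3)[OF xX] CW by auto
          then show ?thesis using \<open>s x = 0\<close> by (simp add: s_def)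
        next
          case False
          then have "\<psi> x = 0" using \<psi>(3)[OF xX] x by auto
          then have "x \<in> C" using \<open>s x = 0\<close> \<phi>(3)[OF xX] by (simp add: s_def)
          then show ?thesis using False CW by blast
        qed
        then obtain j where "j < k" "h j x \<noteq> 0" using h(3) by blast
        then show ?thesis by (intro exI[of _ "Suc j"]) (simp add: g_def)
      qed auto
    qed
  qed
qed


section \<open>Removable zeros bound the dimension\<close>

text \<open>Finite unions of sets from a countable base fit between any closed set and any open set
  around it. One Urysohn function for each pair of such unions with disjoint closures therefore
  suffices. This reduces the uncountably many maps in \<open>avoidable\<close> to countably many
  tests.\<close>

lemma countable_separating_family:
  obtains \<Phi> :: "('a \<Rightarrow> real) set" where "countable \<Phi>"
    "\<forall>\<phi>\<in>\<Phi>. continuous_map X euclideanreal \<phi>"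
    "\<forall>A B. closedin X A \<and> closedin X B \<and> disjnt A B \<longrightarrow>
       (\<exists>\<phi>\<in>\<Phi>. \<phi> ` A \<subseteq> {-1} \<and> \<phi> ` B \<subseteq> {1})"
proof -
  obtain \<B> where B: "countable \<B>" "\<forall>V\<in>\<B>. openin X V"
      "\<forall>U x. openin X U \<and> x \<in> U \<longrightarrow> (\<exists>V\<in>\<B>. x \<in> V \<and> V \<subseteq> U)"
    using second_countable_compact_metric unfolding second_countable_def by (elim exE conjE)
  define \<F> where "\<F> = Union ` {\<U>. finite \<U> \<and> \<U> \<subseteq> \<B>}"
  have cF: "countable \<F>"
    unfolding \<F>_def using countable_Collect_finite_subset[OF B(1)] by simp
  have approx: "\<exists>F\<in>\<F>. C \<subseteq> F \<and> F \<subseteq> U" if C: "closedin X C" and U: "openin X U" "C \<subseteq> U" for C U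
  proof -
    have "C \<subseteq> \<Union>{V\<in>\<B>. V \<subseteq> U}" using B(3) U by blast
    then obtain \<G> where G: "finite \<G>" "\<G> \<subseteq> {V\<in>\<B>. V \<subseteq> U}" "C \<subseteq> \<Union>\<G>"
      using compactinD[OF closedin_imp_compactin[OF C], of "{V\<in>\<B>. V \<subseteq> U}"] B(2) by blast
    then have "\<Union>\<G> \<in> \<F>" unfolding \<F>_def by blast
    then show ?thesis using G by blast
  qed
  define \<P> where "\<P> = {(U,V). U \<in> \<F> \<and> V \<in> \<F> \<and> disjnt (X closure_of U) (X closure_of V)}"
  have "\<exists>\<phi>. continuous_map X euclideanreal \<phi> \<and> \<phi> ` (X closure_of fst p) \<subseteq> {-1} \<and> \<phi> ` (X closure_of snd p) \<subseteq> {1}"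
    if "p \<in> \<P>" for p
  proof -
    have d: "disjnt (X closure_of fst p) (X closure_of snd p)" using that unfolding \<P>_def by auto
    show ?thesis
      using Urysohn_lemma_alt[OF normal closedin_closure_of closedin_closure_of d, of "-1" 1] by metis
  qed
  then obtain \<phi> where \<phi>: "\<And>p. p \<in> \<P> \<Longrightarrow> continuous_map X euclideanreal (\<phi> p)"
    "\<And>p. p \<in> \<P> \<Longrightarrow> \<phi> p ` (X closure_of fst p) \<subseteq> {-1}"
    "\<And>p. p \<in> \<P> \<Longrightarrow> \<phi> p ` (X closure_of snd p) \<subseteq> {1}"
    by metis
  have "countable \<P>" unfolding \<P>_def
    by (rule countable_subset[OF _ countable_SIGMA[OF cF, of "\<lambda>_. \<F>"]]) (use cF in auto)
  then have "countable (\<phi> ` \<P>)" by simp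
  moreover have "\<forall>g\<in>\<phi> ` \<P>. continuous_map X euclideanreal g" using \<phi>(1) by blast
  moreover have "\<exists>g\<in>\<phi> ` \<P>. g ` A \<subseteq> {-1} \<and> g ` B' \<subseteq> {1}"
    if AB: "closedin X A" "closedin X B'" "disjnt A B'" for A B'
  proof -
    obtain U where U: "openin X U" "A \<subseteq> U" "disjnt B' (X closure_of U)"
      using normal AB unfolding normal_space by metis
    obtain V where V: "openin X V" "B' \<subseteq> V" "disjnt (X closure_of U) (X closure_of V)"
      using normal AB(2) U(3) closedin_closure_of[of X U] unfolding normal_space by metis
    obtain F where F: "F \<in> \<F>" "A \<subseteq> F" "F \<subseteq> U" using approx[OF AB(1) U(1,2)] by blast
    obtain G where G: "G \<in> \<F>" "B' \<subseteq> G" "G \<subseteq> V" using approx[OF AB(2) V(1,2)] by blast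
    have "X closure_of F \<subseteq> X closure_of U" "X closure_of G \<subseteq> X closure_of V"
      using F(3) G(3) closure_of_mono by blast+
    then have p: "(F, G) \<in> \<P>" unfolding \<P>_def using F(1) G(1) V(3) by (auto simp: disjnt_iff)
    have "F \<subseteq> topspace X" "G \<subseteq> topspace X"
      using F(3) G(3) openin_subset[OF U(1)] openin_subset[OF V(1)] by auto
    then have "A \<subseteq> X closure_of F" "B' \<subseteq> X closure_of G"
      using F(2) G(2) closure_of_subset[of F X] closure_of_subset[of G X] by auto
    then have "\<phi> (F, G) ` A \<subseteq> {-1}" "\<phi> (F, G) ` B' \<subseteq> {1}"
      using image_mono[of _ _ "\<phi> (F, G)"] \<phi>(2,3)[OF p] unfolding fst_conv snd_conv by blast+
    then show ?thesis using p by blast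
  qed
  ultimately show thesis by (intro that[of "\<phi> ` \<P>"]) blast+
qed

text \<open>By the Baire category theorem, almost every level set \<open>g = 0\<close> lowers the dimension of
  countably many closed sets simultaneously.\<close>

lemma avoidable_zero_set:
  assumes Z: "\<And>j. j \<in> J \<Longrightarrow> closedin X (Z j)" "\<And>j. j \<in> J \<Longrightarrow> avoidable (Suc k) (Z j)"
    and J: "countable J"
    and g0: "continuous_map X euclideanreal g0" and e: "0 < e"
  obtains g where "continuous_map X euclideanreal g" "\<forall>x\<in>topspace X. \<bar>g x - g0 x\<bar> \<le> e"
    "\<forall>j\<in>J. avoidable k {x \<in> Z j. g x = 0}"
proof -
  obtain \<Phi> :: "('a \<Rightarrow> real) set" where P: "countable \<Phi>"
    "\<forall>\<phi>\<in>\<Phi>. continuous_map X euclideanreal \<phi>"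
    "\<forall>A B. closedin X A \<and> closedin X B \<and> disjnt A B \<longrightarrow>
       (\<exists>\<phi>\<in>\<Phi>. \<phi> ` A \<subseteq> {-1} \<and> \<phi> ` B \<subseteq> {1})"
    by (rule countable_separating_family)
  \<comment> \<open>The index \<open>p\<close> names a set \<open>Z j\<close> and a
    \<open>k\<close>-tuple from \<open>\<Phi>\<close>. The test asks to remove the zeros of this
    tuple on the part of \<open>Z j\<close> where \<open>g\<close> vanishes. An error of 1/2 is
    harmless, as only the signs at places with value -1 or 1 will matter.\<close>
  define test :: "'b \<times> ('a \<Rightarrow> real) list \<Rightarrow> ('a \<Rightarrow> real) \<Rightarrow> bool" where
    "test p g \<longleftrightarrow> (\<exists>h. (\<forall>i<k. continuous_map X euclideanreal (h i)) \<and>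
        (\<forall>i<k. \<forall>x\<in>topspace X. \<bar>h i x - (snd p ! i) x\<bar> \<le> 1/2) \<and>
        (\<forall>x\<in>Z (fst p). g x = 0 \<longrightarrow> (\<exists>i<k. h i x \<noteq> 0)))" for p g
  define I where "I = J \<times> {\<phi>s \<in> lists \<Phi>. length \<phi>s = k}"
  have "countable {\<phi>s \<in> lists \<Phi>. length \<phi>s = k}"
    using countable_lists[OF P(1)] by (rule countable_subset[rotated]) auto
  then have cI: "countable I" unfolding I_def using J by simp
  have op: "sup_open X (test p)" if p: "p \<in> I" for p
    unfolding sup_open_def
  proof (intro allI impI, elim conjE)
    fix g assume g: "continuous_map X euclideanreal g" and t: "test p g"
    from t obtain h where h: "\<forall>i<k. continuous_map X euclideanreal (h i)"
      "\<forall>i<k. \<forall>x\<in>topspace X. \<bar>h i x - (snd p ! i) x\<bar> \<le> 1/2"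
      "\<forall>x\<in>Z (fst p). g x = 0 \<longrightarrow> (\<exists>i<k. h i x \<noteq> 0)"
      unfolding test_def by (elim exE conjE)
    \<comment> \<open>With \<open>g\<close> as an extra coordinate, passing the test means having no
      common zero on the whole of \<open>Z (fst p)\<close>, and \<open>nonvanishing_bound\<close>
      applies. At a zero of a nearby \<open>g'\<close> the coordinate \<open>g\<close> is below
      \<open>c\<close>, so some \<open>h j\<close> is not.\<close>
    define u where "u i = (case i of 0 \<Rightarrow> g | Suc j \<Rightarrow> h j)" for i
    have cZ: "closedin X (Z (fst p))" using p Z(1) unfolding I_def by auto
    have uc: "continuous_map X euclideanreal (u i)" if "i < Suc k" for i
      using that g h(1) by (cases i) (auto simp: u_def)
    have un: "\<exists>i<Suc k. u i x \<noteq> 0" if "x \<in> Z (fst p)" for x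
    proof (cases "g x = 0")
      case True
      then obtain i where "i < k" "h i x \<noteq> 0" using h(3) \<open>x \<in> Z (fst p)\<close> by blast
      then show ?thesis by (intro exI[of _ "Suc i"]) (simp add: u_def)
    qed (auto simp: u_def)
    obtain c where c: "0 < c" "\<forall>x\<in>Z (fst p). \<exists>i<Suc k. c \<le> \<bar>u i x\<bar>"
      by (rule nonvanishing_bound[OF cZ uc un])
    show "\<exists>e>0. \<forall>g'. continuous_map X euclideanreal g' \<and> (\<forall>x\<in>topspace X. dist (g' x) (g x) \<le> e) \<longrightarrow> test p g'"
    proof (intro exI[of _ "c/2"] conjI allI impI, goal_cases)
      case 1
      then show ?case using c by simp
    next
      case (2 g')
      have "\<exists>i<k. h i x \<noteq> 0" if x: "x \<in> Z (fst p)" "g' x = 0" for x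
      proof -
        obtain i where i: "i < Suc k" "c \<le> \<bar>u i x\<bar>" using c(2) x by blast
        have "x \<in> topspace X" using cZ x closedin_subset by blast
        then have "dist (g' x) (g x) \<le> c/2" using 2 by blast
        then have "\<bar>g x\<bar> < c" using x c(1) by (simp add: dist_real_def)
        then obtain j where "i = Suc j" using i by (cases i) (auto simp: u_def)
        then show ?thesis using i c(1) by (intro exI[of _ j]) (auto simp: u_def)
      qed
      then show ?case unfolding test_def using h(1,2) by (intro exI[of _ h]) simp
    qed
  qed
  have de: "sup_dense X (test p)" if p: "p \<in> I" for p
    unfolding sup_dense_def
  proof (intro allI impI, elim conjE)
    fix g :: "'a \<Rightarrow> real" and e :: real
    assume g: "continuous_map X euclideanreal g" and e: "0 < e"
    define u where "u i = (case i of 0 \<Rightarrow> g | Suc j \<Rightarrow> snd p ! j)" for i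
    have uc: "continuous_map X euclideanreal (u i)" if "i < Suc k" for i
      using that g p P(2) unfolding I_def by (cases i) (auto simp: u_def in_lists_conv_set)
    have av: "avoidable (Suc k) (Z (fst p))" using p Z(2) unfolding I_def by auto
    have m: "0 < min e (1/2)" using e by simp
    obtain v where v: "\<forall>i<Suc k. continuous_map X euclideanreal (v i)"
      "\<forall>i<Suc k. \<forall>x\<in>topspace X. \<bar>v i x - u i x\<bar> \<le> min e (1/2)"
      "\<forall>x\<in>Z (fst p). \<exists>i<Suc k. v i x \<noteq> 0"
      by (rule avoidableD[OF av uc m])
    \<comment> \<open>The perturbed coordinate 0 is the new \<open>g\<close>; the other coordinates
      are the witnesses of the test.\<close>
    have "test p (v 0)"
      unfolding test_def
    proof (intro exI[of _ "\<lambda>i. v (Suc i)"] conjI allI impI ballI)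
      show "continuous_map X euclideanreal (v (Suc i))" if "i < k" for i using v(1) that by simp
      show "\<bar>v (Suc i) x - (snd p ! i) x\<bar> \<le> 1/2" if "i < k" "x \<in> topspace X" for i x
        using v(2)[rule_format, of "Suc i" x] that by (simp add: u_def)
      fix x assume "x \<in> Z (fst p)" "v 0 x = 0"
      then obtain i where "i < Suc k" "v i x \<noteq> 0" "i \<noteq> 0" using v(3) by metis
      then show "\<exists>i<k. v (Suc i) x \<noteq> 0" by (cases i) auto
    qed
    moreover have "dist (v 0 x) (g x) \<le> e" if "x \<in> topspace X" for x
      using v(2)[rule_format, of 0 x] that by (simp add: u_def dist_real_def)
    ultimately show "\<exists>g'. continuous_map X euclideanreal g' \<and> (\<forall>x\<in>topspace X. dist (g' x) (g x) \<le> e) \<and> test p g'"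
      using v(1) by (intro exI[of _ "v 0"]) auto
  qed
  have "sup_dense X (\<lambda>g. \<forall>p\<in>I. test p g)"
    by (rule sup_dense_Inter[OF compact cI op de])
  from sup_denseD[OF this g0 e]
  obtain g where g: "continuous_map X euclideanreal g" "\<forall>x\<in>topspace X. dist (g x) (g0 x) \<le> e"
      "\<forall>p\<in>I. test p g" .
  have "avoidable k {x \<in> Z j. g x = 0}" if j: "j \<in> J" for j
  proof (rule avoidableI)
    fix f :: "nat \<Rightarrow> 'a \<Rightarrow> real" and d :: real
    assume f: "\<And>i. i < k \<Longrightarrow> continuous_map X euclideanreal (f i)" and d: "0 < d"
    \<comment> \<open>Only the places where \<open>f i\<close> is at least \<open>d\<close> in
      absolute value matter, since elsewhere the clamp may choose any small value. There
      \<open>f i\<close> is replaced by a member of \<open>\<Phi>\<close> of the same sign.\<close>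
    have "\<exists>\<phi>\<in>\<Phi>. \<phi> ` {x \<in> topspace X. f i x \<in> {..-d}} \<subseteq> {-1} \<and> \<phi> ` {x \<in> topspace X. f i x \<in> {d..}} \<subseteq> {1}"
      if "i < k" for i
    proof (rule P(3)[rule_format], intro conjI)
      show "closedin X {x \<in> topspace X. f i x \<in> {..-d}}" "closedin X {x \<in> topspace X. f i x \<in> {d..}}"
        by (rule closedin_continuous_map_preimage[OF f[OF that]]; simp)+
      show "disjnt {x \<in> topspace X. f i x \<in> {..-d}} {x \<in> topspace X. f i x \<in> {d..}}"
        using d by (auto simp: disjnt_iff)
    qed
    then have "\<forall>i. \<exists>\<psi>. i < k \<longrightarrow> \<psi> \<in> \<Phi> \<and> \<psi> ` {x \<in> topspace X. f i x \<in> {..-d}} \<subseteq> {-1} \<and>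
        \<psi> ` {x \<in> topspace X. f i x \<in> {d..}} \<subseteq> {1}"
      unfolding Bex_def by blast
    from choice[OF this] obtain \<phi> where ph: "\<forall>i. i < k \<longrightarrow> \<phi> i \<in> \<Phi> \<and>
        \<phi> i ` {x \<in> topspace X. f i x \<in> {..-d}} \<subseteq> {-1} \<and> \<phi> i ` {x \<in> topspace X. f i x \<in> {d..}} \<subseteq> {1}" ..
    have \<phi>: "\<phi> i \<in> \<Phi>" "\<phi> i ` {x \<in> topspace X. f i x \<in> {..-d}} \<subseteq> {-1}"
      "\<phi> i ` {x \<in> topspace X. f i x \<in> {d..}} \<subseteq> {1}" if "i < k" for i
      using ph[rule_format, OF that] by simp_all
    have "(j, map \<phi> [0..<k]) \<in> I" unfolding I_def using j \<phi>(1) by auto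
    then have t: "test (j, map \<phi> [0..<k]) g" using g(3) by blast
    then obtain h where h: "\<forall>i<k. continuous_map X euclideanreal (h i)"
      "\<forall>i<k. \<forall>x\<in>topspace X. \<bar>h i x - (map \<phi> [0..<k] ! i) x\<bar> \<le> 1/2"
      "\<forall>x\<in>Z j. g x = 0 \<longrightarrow> (\<exists>i<k. h i x \<noteq> 0)"
      unfolding test_def fst_conv snd_conv by (elim exE conjE)
    show "\<exists>u. (\<forall>i<k. continuous_map X euclideanreal (u i) \<and> (\<forall>x\<in>topspace X. \<bar>u i x - f i x\<bar> \<le> d)) \<and>
           (\<forall>x\<in>{x \<in> Z j. g x = 0}. \<exists>i<k. u i x \<noteq> 0)"
    proof (intro exI[of _ "\<lambda>i x. nudge d (f i x) (h i x)"] conjI allI impI ballI)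
      show "continuous_map X euclideanreal (\<lambda>x. nudge d (f i x) (h i x))" if "i < k" for i
        using that f h(1) by (intro continuous_map_nudge) auto
      show "\<bar>nudge d (f i x) (h i x) - f i x\<bar> \<le> d" if "i < k" for i x
        using d by (intro nudge_close) simp
      fix x assume x: "x \<in> {x \<in> Z j. g x = 0}"
      then obtain i where i: "i < k" "h i x \<noteq> 0" using h(3) by blast
      have xX: "x \<in> topspace X" using x Z(1)[OF j] closedin_subset by blast
      have hb: "\<bar>h i x - \<phi> i x\<bar> \<le> 1/2" using h(2)[rule_format, OF i(1) xX] i(1) by simp
      have "nudge d (f i x) (h i x) \<noteq> 0"
      proof
        assume z: "nudge d (f i x) (h i x) = 0"
        have "h i x = 0"
        proof (rule nudge_eq_0[OF z d])
          show "0 < h i x" if "d \<le> f i x"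
          proof -
            have "\<phi> i x = 1" using \<phi>(3)[OF i(1)] xX that by auto
            then show ?thesis using hb by linarith
          qed
          show "h i x < 0" if "f i x \<le> -d"
          proof -
            have "\<phi> i x = -1" using \<phi>(2)[OF i(1)] xX that by auto
            then show ?thesis using hb by linarith
          qed
        qed
        then show False using i by simp
      qed
      then show "\<exists>i<k. nudge d (f i x) (h i x) \<noteq> 0" using i by blast
    qed
  qed
  then show thesis using g(1,2) by (intro that[of g]) (auto simp: dist_real_def)
qed

text \<open>A neighbourhood of \<open>p\<close> is cut out by \<open>g < 0\<close>, and its frontier
  lies in \<open>g = 0\<close>. By \<open>avoidable_zero_set\<close> one \<open>g\<close> lowers
  \<open>k\<close> on all the \<open>Z j\<close> simultaneously, so the frontier lies in a countable
  union of the same kind and the induction continues. Working with unions from the start yields the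
  sum theorem without further effort.\<close>

lemma avoidable_imp_dim_le_Union:
  assumes "countable J" "\<And>j. j \<in> J \<Longrightarrow> closedin X (Z j)" "\<And>j. j \<in> J \<Longrightarrow> avoidable k (Z j)"
  shows "subtopology X (\<Union>j\<in>J. Z j) dim_le (int k - 1)"
  using assms(2,3)
proof (induction k arbitrary: Z)
  case 0
  then have "(\<Union>j\<in>J. Z j) = {}" by auto
  then show ?case by simp
next
  case (Suc k)
  define S where "S = (\<Union>j\<in>J. Z j)"
  define Y where "Y = subtopology X S"
  have "S \<subseteq> topspace X" unfolding S_def using Suc.prems(1) closedin_subset by blast
  then have tY: "topspace Y = S" unfolding Y_def by auto
  have "Y dim_le (int (Suc k) - 1)"
  proof (rule dimension_le.intros)
    show "- 1 \<le> int (Suc k) - 1" by simp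
    fix V p assume V: "openin Y V" and p: "p \<in> V"
    obtain T where T: "openin X T" "V = T \<inter> S"
      using V unfolding Y_def openin_subtopology by blast
    have pX: "p \<in> topspace X" using T p openin_subset by blast
    have d: "disjnt {p} (topspace X - T)" using p T by auto
    have c: "closedin X {p}" "closedin X (topspace X - T)"
      using closedin_t1_singleton[OF t1 pX] openin_closedin_eq[of X T] T(1) by blast+
    obtain g0 where g0: "continuous_map X euclideanreal g0" "g0 ` {p} \<subseteq> {-1}" "g0 ` (topspace X - T) \<subseteq> {1}"
      by (rule Urysohn_lemma_alt[OF normal c d])
    \<comment> \<open>\<open>g0\<close> is -1 at \<open>p\<close> and 1 outside \<open>T\<close>, so
      an error of 1/2 preserves both signs.\<close>
    have half: "0 < (1/2 :: real)" by simp
    obtain g where g: "continuous_map X euclideanreal g" "\<forall>x\<in>topspace X. \<bar>g x - g0 x\<bar> \<le> 1/2"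
      "\<forall>j\<in>J. avoidable k {x \<in> Z j. g x = 0}"
      by (rule avoidable_zero_set[OF Suc.prems assms(1) g0(1) half])
    define U where "U = {x \<in> topspace Y. g x \<in> {..<0}}"
    have gY: "continuous_map Y euclideanreal g" unfolding Y_def using g(1) by (rule continuous_map_from_subtopology)
    have oU: "openin Y U" unfolding U_def by (rule openin_continuous_map_preimage[OF gY]) simp
    have "closedin Y {x \<in> topspace Y. g x \<in> {..0}}" by (rule closedin_continuous_map_preimage[OF gY]) simp
    then have "Y closure_of U \<subseteq> {x \<in> topspace Y. g x \<in> {..0}}"
      by (rule closure_of_minimal[rotated]) (auto simp: U_def)
    moreover have "Y frontier_of U = Y closure_of U - U" by (rule frontier_of_openin[OF oU])
    ultimately have "Y frontier_of U \<subseteq> {x \<in> S. g x = 0}" by (auto simp: U_def tY)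
    then have fr: "Y frontier_of U \<subseteq> (\<Union>j\<in>J. {x \<in> Z j. g x = 0})" unfolding S_def by auto
    show "\<exists>U. p \<in> U \<and> U \<subseteq> V \<and> openin Y U \<and> subtopology Y (Y frontier_of U) dim_le (int (Suc k) - 1 - 1)"
    proof (intro exI[of _ U] conjI oU)
      have "g0 p = -1" using g0(2) by auto
      then have "g p < 0" using g(2)[rule_format, OF pX] by linarith
      moreover have "p \<in> S" using p T by blast
      ultimately show "p \<in> U" unfolding U_def tY by simp
      show "U \<subseteq> V"
      proof
        fix x assume x: "x \<in> U"
        then have xS: "x \<in> S" "g x < 0" unfolding U_def tY by auto
        then have xX: "x \<in> topspace X" using \<open>S \<subseteq> topspace X\<close> by blast
        have "x \<in> T"
        proof (rule ccontr)
          assume "x \<notin> T"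
          then have "g0 x = 1" using g0(3) xX by auto
          then show False using g(2)[rule_format, OF xX] xS(2) by linarith
        qed
        then show "x \<in> V" using xS T by blast
      qed
      have cl: "closedin X {x \<in> Z j. g x = 0}" if "j \<in> J" for j
        using closedin_continuous_map_preimage_gen[OF g(1) Suc.prems(1)[OF that], of "{0}"] by simp
      have "subtopology X (\<Union>j\<in>J. {x \<in> Z j. g x = 0}) dim_le (int k - 1)"
        by (rule Suc.IH[OF cl]) (use g(3) in auto)
      then have "subtopology X (S \<inter> Y frontier_of U) dim_le (int k - 1)"
        by (rule dimension_le_subtopologies) (use fr in blast)
      then show "subtopology Y (Y frontier_of U) dim_le (int (Suc k) - 1 - 1)"
        unfolding Y_def by (simp add: subtopology_subtopology)
    qed
  qed
  then show ?case unfolding Y_def S_def .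
qed

lemma avoidable_imp_dim_le:
  assumes "closedin X Z" "avoidable k Z"
  shows "subtopology X Z dim_le (int k - 1)"
proof -
  have "subtopology X (\<Union>j\<in>{()}. Z) dim_le (int k - 1)"
    by (rule avoidable_imp_dim_le_Union) (use assms in auto)
  then show ?thesis by simp
qed

text \<open>The countable closed sum theorem, obtained by passing through \<open>avoidable\<close>
  and back; dimension \<open>d\<close> corresponds to \<open>k = d + 1\<close> coordinates.\<close>

lemma dim_le_Union_closed:
  assumes "countable J" "\<And>j. j \<in> J \<Longrightarrow> closedin X (Z j)" "\<And>j. j \<in> J \<Longrightarrow> subtopology X (Z j) dim_le d" "-1 \<le> d"
  shows "subtopology X (\<Union>j\<in>J. Z j) dim_le d"
proof -
  define k where "k = nat (d + 1)"
  have k: "d = int k - 1" using assms(4) by (simp add: k_def)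
  have av: "avoidable k (Z j)" if "j \<in> J" for j
    using dim_le_imp_avoidable[OF assms(2)[OF that]] assms(3)[OF that] k by simp
  show ?thesis unfolding k by (rule avoidable_imp_dim_le_Union[OF assms(1,2) av])
qed

end

subsection \<open>Countable bases with small frontiers\<close>

lemma finite_common_radius:
  assumes "finite A" "\<And>a. a \<in> A \<Longrightarrow> \<exists>r>0. Q a r" "\<And>a r s. Q a r \<Longrightarrow> 0 < s \<Longrightarrow> s \<le> r \<Longrightarrow> Q a s"
  shows "\<exists>r>0::real. \<forall>a\<in>A. Q a r"
  using assms(1,2)
proof (induction A rule: finite_induct)
  case empty
  then show ?case by (intro exI[of _ 1]) simp
next
  case (insert a A)
  then obtain r where r: "r > 0" "\<forall>a\<in>A. Q a r" by auto
  obtain s where s: "s > 0" "Q a s" using insert.prems by auto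
  show ?case
  proof (intro exI[of _ "min r s"] conjI ballI)
    fix b assume "b \<in> insert a A"
    then show "Q b (min r s)" using assms(3)[of b r "min r s"] assms(3)[of b s "min r s"] r s by auto
  qed (use r s in auto)
qed

text \<open>For each pair of sets of a countable base, one open set with small frontier is chosen
  between them if there is any. The pairs are countable, and around every point enough of them admit
  a choice.\<close>

lemma countable_dim_base:
  assumes "second_countable Y" "Y dim_le d"
  obtains \<U> where "countable \<U>" "\<forall>U\<in>\<U>. openin Y U \<and> subtopology Y (Y frontier_of U) dim_le (d - 1)"
    "\<forall>V x. openin Y V \<and> x \<in> V \<longrightarrow> (\<exists>U\<in>\<U>. x \<in> U \<and> U \<subseteq> V)"
proof -
  obtain \<C> where C: "countable \<C>" "\<forall>V\<in>\<C>. openin Y V"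
      "\<forall>U x. openin Y U \<and> x \<in> U \<longrightarrow> (\<exists>V\<in>\<C>. x \<in> V \<and> V \<subseteq> U)"
    using assms(1) unfolding second_countable_def by (elim exE conjE)
  define Q where "Q p U \<longleftrightarrow> openin Y U \<and> subtopology Y (Y frontier_of U) dim_le (d - 1) \<and> fst p \<subseteq> U \<and> U \<subseteq> snd p" for p U
  define \<P> where "\<P> = {p \<in> \<C> \<times> \<C>. \<exists>U. Q p U}"
  have "\<forall>p\<in>\<P>. \<exists>U. Q p U" unfolding \<P>_def by blast
  from bchoice[OF this] obtain u where u: "\<forall>p\<in>\<P>. Q p (u p)" ..
  have "countable \<P>" unfolding \<P>_def using C(1) by (intro countable_subset[OF _ countable_SIGMA[OF C(1), of "\<lambda>_. \<C>"]]) auto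
  show thesis
  proof (rule that[of "u ` \<P>"])
    show "countable (u ` \<P>)" using \<open>countable \<P>\<close> by simp
    show "\<forall>U\<in>u ` \<P>. openin Y U \<and> subtopology Y (Y frontier_of U) dim_le (d - 1)"
      using u unfolding Q_def by blast
    show "\<forall>V x. openin Y V \<and> x \<in> V \<longrightarrow> (\<exists>U\<in>u ` \<P>. x \<in> U \<and> U \<subseteq> V)"
    proof (intro allI impI, elim conjE)
      fix V x assume V: "openin Y V" "x \<in> V"
      then obtain C' where C': "C' \<in> \<C>" "x \<in> C'" "C' \<subseteq> V" using C(3) by blast
      have "openin Y C'" using C' C(2) by blast
      with assms(2) obtain U where U: "x \<in> U" "U \<subseteq> C'" "openin Y U" "subtopology Y (Y frontier_of U) dim_le (d - 1)"
        using C'(2) by (rule dim_leE)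
      then obtain C1 where C1: "C1 \<in> \<C>" "x \<in> C1" "C1 \<subseteq> U" using C(3) by blast
      have "Q (C1, C') U" unfolding Q_def using U C1 by simp
      then have p: "(C1, C') \<in> \<P>" unfolding \<P>_def using C1 C' by blast
      then have "Q (C1, C') (u (C1, C'))" using u by blast
      then have "x \<in> u (C1, C')" "u (C1, C') \<subseteq> V" unfolding Q_def using C1 C' by auto
      then show "\<exists>U\<in>u ` \<P>. x \<in> U \<and> U \<subseteq> V" using p by blast
    qed
  qed
qed

text \<open>The frontier of \<open>S \<inter> U\<close> within \<open>S\<close> is contained in the
  frontier of \<open>U\<close> within \<open>Z\<close>. Thus one fixed base of \<open>Z\<close>
  bounds the dimension of any subset, be it a complement or a fibre.\<close>

lemma dim_le_of_base:
  assumes "-1 \<le> d" "S \<subseteq> Z"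
    and O: "\<And>U. U \<in> \<U> \<Longrightarrow> openin (subtopology X Z) U"
    and base: "\<forall>V x. openin (subtopology X Z) V \<and> x \<in> V \<longrightarrow> (\<exists>U\<in>\<U>. x \<in> U \<and> U \<subseteq> V)"
    and dim: "\<And>U. U \<in> \<U> \<Longrightarrow> subtopology X (S \<inter> subtopology X Z frontier_of U) dim_le (d - 1)"
  shows "subtopology X S dim_le d"
proof (rule dimension_le.intros)
  define Y where "Y = subtopology X Z"
  have YS: "subtopology X S = subtopology Y S"
    unfolding Y_def using assms(2) by (simp add: subtopology_subtopology Int_absorb1)
  fix V a assume V: "openin (subtopology X S) V" "a \<in> V"
  then obtain T where T: "openin X T" "V = T \<inter> S" unfolding openin_subtopology by blast
  have "openin Y (T \<inter> Z)" unfolding Y_def openin_subtopology using T(1) by blast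
  moreover have "a \<in> T \<inter> Z" using V T assms(2) by blast
  ultimately obtain U where U: "U \<in> \<U>" "a \<in> U" "U \<subseteq> T \<inter> Z" using base unfolding Y_def by blast
  show "\<exists>U. a \<in> U \<and> U \<subseteq> V \<and> openin (subtopology X S) U \<and>
      subtopology (subtopology X S) (subtopology X S frontier_of U) dim_le (d - 1)"
  proof (intro exI[of _ "S \<inter> U"] conjI)
    show "a \<in> S \<inter> U" "S \<inter> U \<subseteq> V" using U V T by auto
    show "openin (subtopology X S) (S \<inter> U)"
      unfolding YS using O[OF U(1)] unfolding Y_def[symmetric] by (simp add: openin_subtopology_Int2)
    have "subtopology Y S frontier_of (S \<inter> U) = subtopology Y S frontier_of U"
      unfolding frontier_of_restrict[of "subtopology Y S" U]
        frontier_of_restrict[of "subtopology Y S" "S \<inter> U"]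
      by (rule arg_cong[of _ _ "\<lambda>A. _ frontier_of A"]) auto
    then have "S \<inter> subtopology Y S frontier_of (S \<inter> U) \<subseteq> S \<inter> Y frontier_of U"
      using frontier_of_subtopology_subset[of S Y U] by auto
    then have "subtopology X (S \<inter> subtopology Y S frontier_of (S \<inter> U)) dim_le (d - 1)"
      by (rule dimension_le_subtopologies[OF dim[OF U(1)], folded Y_def])
    then show "subtopology (subtopology X S) (subtopology X S frontier_of (S \<inter> U)) dim_le (d - 1)"
      unfolding subtopology_subtopology YS[symmetric] .
  qed
qed (rule assms(1))

context compact_metric
begin

section \<open>Decomposition of a closed set by frontiers\<close>

lemma countable_frontier_base:
  assumes Z: "closedin X Z" "subtopology X Z dim_le d"
  obtains \<U> where "countable \<U>" "\<forall>U\<in>\<U>. openin (subtopology X Z) U"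
    "\<forall>U\<in>\<U>. closedin X (subtopology X Z frontier_of U)"
    "\<forall>U\<in>\<U>. subtopology X (subtopology X Z frontier_of U) dim_le (d - 1)"
    "\<forall>V x. openin (subtopology X Z) V \<and> x \<in> V \<longrightarrow> (\<exists>U\<in>\<U>. x \<in> U \<and> U \<subseteq> V)"
proof -
  obtain \<U> where U: "countable \<U>"
    "\<forall>U\<in>\<U>. openin (subtopology X Z) U \<and> subtopology (subtopology X Z) (subtopology X Z frontier_of U) dim_le (d - 1)"
    "\<forall>V x. openin (subtopology X Z) V \<and> x \<in> V \<longrightarrow> (\<exists>U\<in>\<U>. x \<in> U \<and> U \<subseteq> V)"
    by (rule countable_dim_base[OF second_countable_subtopology[OF second_countable_compact_metric] Z(2)])
  show thesis
  proof (rule that[of \<U>])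
    show "\<forall>U\<in>\<U>. closedin X (subtopology X Z frontier_of U)"
      using closedin_trans_full[OF closedin_frontier_of Z(1)] by blast
    show "\<forall>U\<in>\<U>. subtopology X (subtopology X Z frontier_of U) dim_le (d - 1)"
    proof
      fix U assume "U \<in> \<U>"
      then have "subtopology (subtopology X Z) (subtopology X Z frontier_of U) dim_le (d - 1)" using U(2) by blast
      moreover have "Z \<inter> subtopology X Z frontier_of U = subtopology X Z frontier_of U"
        using frontier_of_subset_subtopology[of X Z U] by blast
      ultimately show "subtopology X (subtopology X Z frontier_of U) dim_le (d - 1)"
        unfolding subtopology_subtopology by simp
    qed
  qed (use U in auto)
qed

text \<open>Induction on \<open>k\<close>: apply the decomposition to each frontier of a countable
  base and collect all the closed sets obtained. What remains of \<open>Z\<close> meets each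
  frontier in dimension at most \<open>k - 1\<close> and so has dimension at most
  \<open>k\<close>.\<close>

lemma dim_decomposition:
  "closedin X Z \<Longrightarrow> subtopology X Z dim_le (e + int k) \<Longrightarrow> -1 \<le> e \<Longrightarrow>
    \<exists>\<C>. countable \<C> \<and> (\<forall>C\<in>\<C>. closedin X C \<and> subtopology X C dim_le e) \<and>
        subtopology X (Z - \<Union>\<C>) dim_le (int k - 1)"
proof (induction k arbitrary: Z)
  case 0
  then show ?case by (intro exI[of _ "{Z}"]) auto
next
  case (Suc k)
  obtain \<U> where U: "countable \<U>" "\<forall>U\<in>\<U>. openin (subtopology X Z) U"
    "\<forall>U\<in>\<U>. closedin X (subtopology X Z frontier_of U)"
    "\<forall>U\<in>\<U>. subtopology X (subtopology X Z frontier_of U) dim_le (e + int (Suc k) - 1)"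
    "\<forall>V x. openin (subtopology X Z) V \<and> x \<in> V \<longrightarrow> (\<exists>U\<in>\<U>. x \<in> U \<and> U \<subseteq> V)"
    by (rule countable_frontier_base[OF Suc.prems(1,2)])
  have "\<forall>U\<in>\<U>. \<exists>\<C>. countable \<C> \<and> (\<forall>C\<in>\<C>. closedin X C \<and> subtopology X C dim_le e) \<and>
        subtopology X (subtopology X Z frontier_of U - \<Union>\<C>) dim_le (int k - 1)"
  proof
    fix U assume "U \<in> \<U>"
    then have "closedin X (subtopology X Z frontier_of U)"
        "subtopology X (subtopology X Z frontier_of U) dim_le (e + int k)"
      using U(3,4) by (auto simp: algebra_simps)
    then show "\<exists>\<C>. countable \<C> \<and> (\<forall>C\<in>\<C>. closedin X C \<and> subtopology X C dim_le e) \<and>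
        subtopology X (subtopology X Z frontier_of U - \<Union>\<C>) dim_le (int k - 1)"
      using Suc.prems(3) by (rule Suc.IH)
  qed
  from bchoice[OF this] obtain c where c: "\<forall>U\<in>\<U>. countable (c U) \<and> (\<forall>C\<in>c U. closedin X C \<and> subtopology X C dim_le e) \<and>
        subtopology X (subtopology X Z frontier_of U - \<Union>(c U)) dim_le (int k - 1)" ..
  define \<C> where "\<C> = (\<Union>U\<in>\<U>. c U)"
  have "subtopology X (Z - \<Union>\<C>) dim_le (int (Suc k) - 1)"
  proof (rule dim_le_of_base[where Z=Z and \<U>=\<U>])
    fix U assume UU: "U \<in> \<U>"
    show "openin (subtopology X Z) U" using U(2) UU by blast
    have "subtopology X (subtopology X Z frontier_of U - \<Union>(c U)) dim_le (int k - 1)" using c UU by blast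
    then have "subtopology X ((Z - \<Union>\<C>) \<inter> subtopology X Z frontier_of U) dim_le (int k - 1)"
      by (rule dimension_le_subtopologies) (use UU in \<open>auto simp: \<C>_def\<close>)
    then show "subtopology X ((Z - \<Union>\<C>) \<inter> subtopology X Z frontier_of U) dim_le (int (Suc k) - 1 - 1)" by simp
  qed (use U(5) in auto)
  moreover have "countable \<C>" unfolding \<C>_def using U(1) c by blast
  ultimately show ?case using c unfolding \<C>_def by (intro exI[of _ "\<Union>U\<in>\<U>. c U"]) auto
qed

subsection \<open>Covers by families of small disjoint closed sets\<close>

text \<open>A Urysohn function separating the two sets is uniformly continuous, so it cannot jump by
  1 over short distances.\<close>

lemma disjoint_closed_distance:
  assumes "closedin X S" "closedin X T" "disjnt S T"
  shows "\<exists>r>0. \<forall>x\<in>S. \<forall>y\<in>T. r \<le> mdist K x y"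
proof -
  obtain f where f: "continuous_map X euclideanreal f" "f ` S \<subseteq> {0}" "f ` T \<subseteq> {1}"
    by (rule Urysohn_lemma_alt[OF normal assms, of 0 1])
  obtain d where d: "0 < d" "\<And>x y. x \<in> mspace K \<Longrightarrow> y \<in> mspace K \<Longrightarrow> mdist K x y < d \<Longrightarrow> dist (f x) (f y) < 1"
    using uniformly_continuous[OF f(1), of 1] by auto
  have "d \<le> mdist K x y" if "x \<in> S" "y \<in> T" for x y
  proof (rule ccontr)
    assume "\<not> d \<le> mdist K x y"
    moreover have "x \<in> mspace K" "y \<in> mspace K" using that assms closedin_subset by fastforce+
    ultimately have "dist (f x) (f y) < 1" using d(2) by simp
    moreover have "f x = 0" "f y = 1" using that f by auto
    ultimately show False by (simp add: dist_real_def)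
  qed
  then show ?thesis using d(1) by blast
qed

text \<open>Cover \<open>Z\<close> by finitely many small open sets with small frontiers. By
  induction \<open>k\<close> families cover the union \<open>L\<close> of the frontiers, and they
  stay small and disjoint after a slight thickening. Outside the thickening the open cover splits
  into disjoint closed pieces, which form the last family.\<close>

lemma small_disjoint_families:
  "closedin X Z \<Longrightarrow> subtopology X Z dim_le (int k - 1) \<Longrightarrow> 0 < \<delta> \<Longrightarrow>
    \<exists>\<S>::nat \<Rightarrow> 'a set set.
      (\<forall>i<k. finite (\<S> i) \<and> pairwise disjnt (\<S> i) \<and>
             (\<forall>S\<in>\<S> i. closedin X S \<and> (\<forall>x\<in>S. \<forall>y\<in>S. mdist K x y \<le> \<delta>))) \<and>
      Z \<subseteq> (\<Union>i<k. \<Union>(\<S> i))"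
proof (induction k arbitrary: Z \<delta>)
  case 0
  have "avoidable 0 Z" by (rule dim_le_imp_avoidable[OF 0(1,2)])
  then show ?case by simp
next
  case (Suc k)
  define Y where "Y = subtopology X Z"
  have ZX: "Z \<subseteq> mspace K" using Suc.prems(1) closedin_subset by fastforce
  then have tY: "topspace Y = Z" unfolding Y_def by auto
  have Yd: "Y dim_le int (Suc k) - 1" using Suc.prems(2) by (simp only: Y_def)
  define \<U> where "\<U> = {U. openin Y U \<and> subtopology Y (Y frontier_of U) dim_le (int k - 1) \<and>
      (\<forall>x\<in>Y closure_of U. \<forall>y\<in>Y closure_of U. mdist K x y \<le> \<delta>)}"
  have "Z \<subseteq> \<Union>\<U>"
  proof
    fix z assume z: "z \<in> Z"
    have "openin X (mball z (\<delta>/2))" using openin_mball by simp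
    then have "openin Y (mball z (\<delta>/2) \<inter> Z)" unfolding Y_def openin_subtopology by blast
    moreover have "z \<in> mball z (\<delta>/2) \<inter> Z" using z ZX Suc.prems(3) by auto
    ultimately obtain U where U: "z \<in> U" "U \<subseteq> mball z (\<delta>/2) \<inter> Z" "openin Y U"
        "subtopology Y (Y frontier_of U) dim_le (int (Suc k) - 1 - 1)"
      by (rule dim_leE[OF Yd])
    have "closedin X (mcball z (\<delta>/2))" using closedin_mcball by simp
    then have "closedin Y (mcball z (\<delta>/2) \<inter> Z)" unfolding Y_def closedin_subtopology by blast
    then have cl: "Y closure_of U \<subseteq> mcball z (\<delta>/2) \<inter> Z"
      by (rule closure_of_minimal[rotated]) (use U(2) mball_subset_mcball in blast)
    have "mdist K x y \<le> \<delta>" if "x \<in> Y closure_of U" "y \<in> Y closure_of U" for x y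
    proof -
      have "x \<in> mcball z (\<delta>/2)" "y \<in> mcball z (\<delta>/2)" using cl that by auto
      then show ?thesis using mdist_triangle[of x K z y] commute[of x z] by auto
    qed
    then have "U \<in> \<U>" using U unfolding \<U>_def by simp
    then show "z \<in> \<Union>\<U>" using U(1) by blast
  qed
  moreover have "compactin Y Z" unfolding Y_def by (simp add: compactin_subtopology closedin_imp_compactin Suc.prems(1))
  ultimately obtain \<F> where F: "finite \<F>" "\<F> \<subseteq> \<U>" "Z \<subseteq> \<Union>\<F>"
    using compactinD[of Y Z \<U>] unfolding \<U>_def by blast
  obtain us where us: "set us = \<F>" using finite_list[OF F(1)] by blast
  define L where "L = (\<Union>U\<in>\<F>. Y frontier_of U)"
  have frc: "closedin X (Y frontier_of U)" for U
    using closedin_trans_full[OF closedin_frontier_of[of Y U, unfolded Y_def] Suc.prems(1)] unfolding Y_def .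
  have L1: "closedin X L" unfolding L_def using F(1) frc by (intro closedin_Union) auto
  have L2: "subtopology X L dim_le (int k - 1)"
    unfolding L_def
  proof (rule dim_le_Union_closed)
    show "countable \<F>" using F(1) by (rule countable_finite)
    fix U assume U: "U \<in> \<F>"
    show "closedin X (Y frontier_of U)" by (rule frc)
    have "subtopology Y (Y frontier_of U) dim_le (int k - 1)" using U F(2) unfolding \<U>_def by blast
    moreover have "Z \<inter> Y frontier_of U = Y frontier_of U"
      using frontier_of_subset_subtopology[of X Z U] unfolding Y_def by blast
    ultimately show "subtopology X (Y frontier_of U) dim_le (int k - 1)"
      unfolding Y_def subtopology_subtopology by simp
  qed simp
  have "0 < \<delta>/5" using Suc.prems(3) by simp
  from Suc.IH[OF L1 L2 this] obtain \<S> where S: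
    "\<forall>i<k. finite (\<S> i) \<and> pairwise disjnt (\<S> i) \<and>
             (\<forall>S\<in>\<S> i. closedin X S \<and> (\<forall>x\<in>S. \<forall>y\<in>S. mdist K x y \<le> \<delta>/5))"
    "L \<subseteq> (\<Union>i<k. \<Union>(\<S> i))" by (elim exE conjE)
  define Pr where "Pr = (\<Union>i<k. {(S,S'). S \<in> \<S> i \<and> S' \<in> \<S> i \<and> S \<noteq> S'})"
  have "\<exists>r>0. \<forall>p\<in>Pr. \<forall>x\<in>fst p. \<forall>y\<in>snd p. r \<le> mdist K x y"
  proof (rule finite_common_radius)
    have "Pr \<subseteq> (\<Union>i<k. \<S> i \<times> \<S> i)" unfolding Pr_def by auto
    then show "finite Pr" by (rule finite_subset) (use S(1) in auto)
    fix p assume "p \<in> Pr"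
    then obtain i S1 S2 where "i < k" "p = (S1, S2)" "S1 \<in> \<S> i" "S2 \<in> \<S> i" "S1 \<noteq> S2"
      unfolding Pr_def by blast
    then show "\<exists>r>0. \<forall>x\<in>fst p. \<forall>y\<in>snd p. r \<le> mdist K x y"
      using S(1) by (intro disjoint_closed_distance) (auto simp: pairwise_def)
  qed fastforce
  then obtain r where r: "r > 0" "\<And>p x y. p \<in> Pr \<Longrightarrow> x \<in> fst p \<Longrightarrow> y \<in> snd p \<Longrightarrow> r \<le> mdist K x y" by blast
  \<comment> \<open>Closed thickenings reach less than \<open>2 * \<eta>\<close> beyond
    \<open>S\<close>. The bound by \<open>\<delta>/5\<close> keeps diameters within
    \<open>\<delta>\<close>, as four \<open>\<eta>\<close> and the old \<open>\<delta>/5\<close> add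
    up to at most \<open>\<delta>\<close>; the bound by \<open>r/4\<close> keeps the thickenings
    disjoint.\<close>
  define \<eta> where "\<eta> = min (\<delta>/5) (r/4)"
  have \<eta>: "0 < \<eta>" "\<eta> \<le> \<delta>/5" "4 * \<eta> \<le> r" unfolding \<eta>_def using r Suc.prems(3) by auto
  define N where "N S = (\<Union>s\<in>S. mball s \<eta>)" for S
  have oN: "openin X (N S)" for S unfolding N_def using openin_mball by auto
  have clN: "\<exists>s\<in>S. mdist K s x < 2 * \<eta>" if "x \<in> X closure_of (N S)" for x S
  proof -
    have x: "x \<in> mspace K" "\<exists>y\<in>N S. y \<in> mball x \<eta>"
      using that \<eta>(1) metric_closure_of[of "N S"] by auto
    then obtain y s where "s \<in> S" "y \<in> mball s \<eta>" "y \<in> mball x \<eta>" unfolding N_def by blast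
    then show ?thesis using mdist_triangle[of s K y x] commute[of x y] by (intro bexI[of _ s]) auto
  qed
  have clNK: "X closure_of (N S) \<subseteq> mspace K" for S using closure_of_subset_topspace[of X "N S"] by simp
  have SK: "S \<subseteq> mspace K" if "i < k" "S \<in> \<S> i" for i S
    using S(1)[rule_format, OF that(1)] that(2) closedin_subset[of X S] by simp
  define G where "G = (\<Union>i<k. \<Union>S\<in>\<S> i. N S)"
  have oG: "openin X G" unfolding G_def using oN by blast
  have LG: "L \<subseteq> G"
  proof
    fix x assume x: "x \<in> L"
    then obtain i S where iS: "i < k" "S \<in> \<S> i" "x \<in> S" using S(2) by blast
    have "x \<in> mspace K" using x L1 closedin_subset by fastforce
    then have "x \<in> N S" unfolding N_def using iS \<eta>(1) by auto
    then show "x \<in> G" unfolding G_def using iS by blast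
  qed
  \<comment> \<open>Taking the closure of \<open>us ! j\<close> makes the piece closed. Since the
    frontier of \<open>us ! j\<close> lies in \<open>G\<close>, the piece is nevertheless contained
    in \<open>us ! j\<close>, and removing the earlier sets makes the pieces disjoint.\<close>
  define T where "T j = Y closure_of (us ! j) \<inter> (Z - (\<Union>i<j. us ! i)) - G" for j
  have usU: "us ! j \<in> \<U>" if "j < length us" for j using that us F(2) nth_mem by blast
  have TU: "T j \<subseteq> us ! j" if j: "j < length us" for j
  proof -
    have "openin Y (us ! j)" using usU[OF j] unfolding \<U>_def by blast
    then have "Y closure_of (us ! j) - us ! j = Y frontier_of (us ! j)" by (simp add: frontier_of_openin)
    also have "\<dots> \<subseteq> G" using LG j us nth_mem unfolding L_def by blast
    finally show ?thesis unfolding T_def by blast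
  qed
  have Tdisj: "T j \<inter> T j' = {}" if "j < j'" "j' < length us" for j j'
    using TU[of j] that unfolding T_def[of j'] by fastforce
  have Tclosed: "closedin X (T j)" if j: "j < length us" for j
  proof -
    have "openin Y (\<Union>i<j. us ! i)" using usU j unfolding \<U>_def by fastforce
    then have "closedin Y (Z - (\<Union>i<j. us ! i))" using tY by blast
    then have "closedin Y (Y closure_of (us ! j) \<inter> (Z - (\<Union>i<j. us ! i)))"
      by (intro closedin_Int closedin_closure_of)
    then have "closedin X (Y closure_of (us ! j) \<inter> (Z - (\<Union>i<j. us ! i)))"
      unfolding Y_def using Suc.prems(1) by (rule closedin_trans_full)
    then show ?thesis unfolding T_def using oG by (rule closedin_diff)
  qed
  define \<T> where "\<T> i = (if i < k then (\<lambda>S. X closure_of (N S)) ` \<S> i else T ` {..<length us})" for i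
  have "finite (\<T> i) \<and> pairwise disjnt (\<T> i) \<and>
             (\<forall>S\<in>\<T> i. closedin X S \<and> (\<forall>x\<in>S. \<forall>y\<in>S. mdist K x y \<le> \<delta>))" if "i < Suc k" for i
  proof (cases "i < k")
    case True
    have "pairwise disjnt ((\<lambda>S. X closure_of (N S)) ` \<S> i)"
    proof (rule pairwiseI)
      fix A B assume AB: "A \<in> (\<lambda>S. X closure_of (N S)) ` \<S> i" "B \<in> (\<lambda>S. X closure_of (N S)) ` \<S> i" "A \<noteq> B"
      then obtain S1 S2 where S12: "A = X closure_of (N S1)" "B = X closure_of (N S2)" "S1 \<in> \<S> i" "S2 \<in> \<S> i" "S1 \<noteq> S2"
        by blast
      then have p: "(S1, S2) \<in> Pr" using True unfolding Pr_def by blast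
      show "disjnt A B"
      proof (rule ccontr)
        assume "\<not> disjnt A B"
        then obtain x where x: "x \<in> A" "x \<in> B" unfolding disjnt_iff by blast
        obtain s1 where s1: "s1 \<in> S1" "mdist K s1 x < 2 * \<eta>"
          using clN[OF x(1)[unfolded S12(1)]] by blast
        obtain s2 where s2: "s2 \<in> S2" "mdist K s2 x < 2 * \<eta>"
          using clN[OF x(2)[unfolded S12(2)]] by blast
        note s = s1 s2
        have m: "s1 \<in> mspace K" "s2 \<in> mspace K" "x \<in> mspace K"
          using SK[OF True S12(3)] SK[OF True S12(4)] s x(1) clNK[of S1] unfolding S12(1) by auto
        have "mdist K s1 s2 < 4 * \<eta>"
          using mdist_triangle[OF m(1,3,2)] s commute[of s2 x] by simp
        then show False using r(2)[OF p, of s1 s2] s \<eta>(3) by simp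
      qed
    qed
    moreover have "mdist K x y \<le> \<delta>" if S': "S' \<in> \<S> i" and xy: "x \<in> X closure_of (N S')" "y \<in> X closure_of (N S')" for S' x y
    proof -
      obtain s1 where s1: "s1 \<in> S'" "mdist K s1 x < 2 * \<eta>" using clN[OF xy(1)] by blast
      obtain s2 where s2: "s2 \<in> S'" "mdist K s2 y < 2 * \<eta>" using clN[OF xy(2)] by blast
      have m: "s1 \<in> mspace K" "s2 \<in> mspace K" "x \<in> mspace K" "y \<in> mspace K"
        using SK[OF True S'] s1 s2 xy clNK[of S'] by auto
      have "mdist K s1 s2 \<le> \<delta>/5" using S(1)[rule_format, OF True] S' s1 s2 by simp
      moreover have "mdist K x y \<le> mdist K x s1 + mdist K s1 s2 + mdist K s2 y"
        using mdist_triangle[OF m(3,1,4)] mdist_triangle[OF m(1,2,4)] by simp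
      ultimately show ?thesis using s1 s2 commute[of x s1] \<eta>(2) by simp
    qed
    ultimately show ?thesis unfolding \<T>_def using True S(1) by auto
  next
    case False
    have "pairwise disjnt (T ` {..<length us})"
    proof (rule pairwiseI)
      fix A B assume AB: "A \<in> T ` {..<length us}" "B \<in> T ` {..<length us}" "A \<noteq> B"
      then obtain j j' where j: "A = T j" "B = T j'" "j < length us" "j' < length us" "j \<noteq> j'" by blast
      then show "disjnt A B" using Tdisj[of j j'] Tdisj[of j' j] unfolding disjnt_def by (cases "j < j'") auto
    qed
    moreover have "mdist K x y \<le> \<delta>" if "j < length us" "x \<in> T j" "y \<in> T j" for j x y
      using usU[OF that(1)] that(2,3) unfolding \<U>_def T_def by blast
    ultimately show ?thesis unfolding \<T>_def using False Tclosed by auto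
  qed
  moreover have "Z \<subseteq> (\<Union>i<Suc k. \<Union>(\<T> i))"
  proof
    fix x assume x: "x \<in> Z"
    show "x \<in> (\<Union>i<Suc k. \<Union>(\<T> i))"
    proof (cases "x \<in> G")
      case True
      then obtain i S' where i: "i < k" "S' \<in> \<S> i" "x \<in> N S'" unfolding G_def by blast
      then have "x \<in> X closure_of (N S')" using closure_of_subset[OF openin_subset[OF oN]] by blast
      then have "x \<in> \<Union>(\<T> i)" unfolding \<T>_def using i by auto
      then show ?thesis using i by auto
    next
      case False
      have "\<exists>j<length us. x \<in> us ! j" using x F(3) us by (metis UnionE in_set_conv_nth subsetD)
      then have ex: "\<exists>j. j < length us \<and> x \<in> us ! j" by blast
      define j where "j = (LEAST j. j < length us \<and> x \<in> us ! j)"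
      have j: "j < length us" "x \<in> us ! j" using LeastI_ex[OF ex] unfolding j_def by auto
      have "x \<notin> us ! i" if "i < j" for i
        using not_less_Least[of i "\<lambda>j. j < length us \<and> x \<in> us ! j"] that j(1) unfolding j_def[symmetric] by simp
      moreover have "x \<in> Y closure_of (us ! j)"
      proof -
        have "openin Y (us ! j)" using usU[OF j(1)] unfolding \<U>_def by blast
        then show ?thesis using closure_of_subset[OF openin_subset] j(2) by blast
      qed
      ultimately have "x \<in> T j" unfolding T_def using x False by blast
      then have "x \<in> \<Union>(\<T> k)" unfolding \<T>_def using j(1) by auto
      then show ?thesis by auto
    qed
  qed
  ultimately show ?case by (intro exI[of _ \<T>]) blast
qed

end

subsection \<open>Fibres of maps into a space of the same dimension\<close>

lemma continuous_map_vec: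
  fixes f :: "'a \<Rightarrow> real ^ 'n"
  shows "continuous_map X euclidean f \<longleftrightarrow> (\<forall>c. continuous_map X euclideanreal (\<lambda>x. f x $ c))"
  unfolding continuous_map_atin by (auto intro: vec_tendstoI tendsto_vec_nth)

lemma dist_vec_le:
  fixes u v :: "real ^ 'n"
  assumes "\<And>c. \<bar>u $ c - v $ c\<bar> \<le> e"
  shows "dist u v \<le> real CARD('n) * e"
proof -
  have "dist u v \<le> (\<Sum>c\<in>UNIV. \<bar>(u - v) $ c\<bar>)" unfolding dist_norm by (rule norm_le_l1_cart)
  also have "\<dots> \<le> (\<Sum>c\<in>(UNIV :: 'n set). e)" by (rule sum_mono) (use assms in auto)
  finally show ?thesis by simp
qed

lemma finite_injective_approx:
  fixes t :: "'b \<Rightarrow> real"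
  assumes "finite A" "0 < e"
  shows "\<exists>v. inj_on v A \<and> (\<forall>a\<in>A. \<bar>v a - t a\<bar> \<le> e)"
  using assms(1)
proof (induction A rule: finite_induct)
  case (insert a A)
  then obtain v where v: "inj_on v A" "\<forall>a\<in>A. \<bar>v a - t a\<bar> \<le> e" by blast
  have "infinite {t a .. t a + e}" using assms(2) by (simp add: infinite_Icc)
  then have "infinite ({t a .. t a + e} - v ` A)" using insert.hyps(1) by (simp add: Diff_infinite_finite)
  then obtain s where s: "s \<in> {t a .. t a + e} - v ` A" by (metis finite.emptyI ex_in_conv)
  show ?case
  proof (intro exI[of _ "v(a := s)"] conjI ballI)
    show "inj_on (v(a := s)) (insert a A)"
      using v(1) s insert.hyps(2) by (auto simp: inj_on_def)
    fix b assume "b \<in> insert a A"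
    then show "\<bar>(v(a := s)) b - t b\<bar> \<le> e" using v(2) s by auto
  qed
qed simp

text \<open>The \<open>n + 1\<close> candidates \<open>c j\<close> are at least
  \<open>4 * \<delta>\<close> apart, while \<open>d\<close> varies by at most
  \<open>3 * \<delta>\<close> on each of at most \<open>n\<close> sets. Each set rules out at most
  one candidate.\<close>

lemma finite_pigeonhole_radius:
  fixes d :: "'a \<Rightarrow> real" and \<delta> :: real
  assumes "finite \<A>" "card \<A> \<le> n" "0 < \<delta>"
    and "\<And>A x y. A \<in> \<A> \<Longrightarrow> x \<in> A \<Longrightarrow> y \<in> A \<Longrightarrow> \<bar>d x - d y\<bar> \<le> 3 * \<delta>"
  obtains t where "0 < t" "t \<le> (4 * real n + 1) * \<delta>" "\<forall>x\<in>\<Union>\<A>. d x \<noteq> t"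
proof -
  define c where "c j = (4 * real j + 1) * \<delta>" for j :: nat
  have "\<exists>j\<le>n. \<forall>x\<in>\<Union>\<A>. d x \<noteq> c j"
  proof (rule ccontr)
    assume "\<not> ?thesis"
    then have "\<forall>j\<in>{..n}. \<exists>A. A \<in> \<A> \<and> (\<exists>x\<in>A. d x = c j)" by blast
    from bchoice[OF this] obtain A where A: "\<forall>j\<in>{..n}. A j \<in> \<A> \<and> (\<exists>x\<in>A j. d x = c j)" ..
    have "\<not> inj_on A {..n}"
    proof
      assume "inj_on A {..n}"
      then have "card {..n} \<le> card \<A>"
        by (rule card_inj_on_le) (use A assms(1) in auto)
      then show False using assms(2) by simp
    qed
    then obtain i j where ij: "i \<le> n" "j \<le> n" "i < j" "A i = A j"
      unfolding inj_on_def by (metis atMost_iff linorder_neqE_nat)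
    have "\<exists>x\<in>A i. d x = c i" using A ij(1) by simp
    then obtain x where x: "x \<in> A i" "d x = c i" by blast
    have "\<exists>y\<in>A j. d y = c j" using A ij(2) by simp
    then obtain y where y: "y \<in> A i" "d y = c j" unfolding ij(4)[symmetric] by blast
    have "A i \<in> \<A>" using A ij(1) by simp
    then have "\<bar>c i - c j\<bar> \<le> 3 * \<delta>" using assms(4)[of "A i" x y] x y by simp
    moreover have "c j - c i = 4 * (real j - real i) * \<delta>" unfolding c_def by (simp add: algebra_simps)
    moreover have "4 * 1 * \<delta> \<le> 4 * (real j - real i) * \<delta>"
      using ij(3) assms(3) by (intro mult_right_mono mult_left_mono) auto
    ultimately show False using assms(3) by linarith
  qed
  then obtain j where j: "j \<le> n" "\<forall>x\<in>\<Union>\<A>. d x \<noteq> c j" by blast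
  show thesis
  proof (rule that[of "c j"])
    show "0 < c j" unfolding c_def using assms(3) by (simp add: add_nonneg_pos)
    show "c j \<le> (4 * real n + 1) * \<delta>" unfolding c_def using j(1) assms(3) by (intro mult_right_mono) auto
  qed (use j in auto)
qed

context compact_metric
begin

text \<open>The union of the \<open>n\<close> sets in \<open>\<A>\<close> and the members of \<open>\<T>\<close> meeting them misses some small sphere
  about \<open>a\<close>; the other members of \<open>\<T>\<close> are isolated.\<close>

lemma zero_dim_criterion:
  assumes "\<And>\<delta>. 0 < \<delta> \<Longrightarrow> \<exists>\<T> \<A>. finite \<T> \<and> pairwise disjnt \<T> \<and> finite \<A> \<and> card \<A> \<le> n \<and>
      (\<forall>S\<in>\<T> \<union> \<A>. closedin X S \<and> (\<forall>x\<in>S. \<forall>y\<in>S. mdist K x y \<le> \<delta>)) \<and> Z \<subseteq> \<Union>\<T> \<union> \<Union>\<A>"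
  shows "subtopology X Z dim_le 0"
proof (rule dimension_le.intros)
  fix V a assume V: "openin (subtopology X Z) V" "a \<in> V"
  define W where "W = subtopology X Z"
  obtain T where T: "openin X T" "V = T \<inter> Z" using V(1) unfolding openin_subtopology by blast
  then have aT: "a \<in> T" "a \<in> Z" using V by auto
  obtain r where r: "0 < r" "mball a r \<subseteq> T" using T(1) aT openin_mtopology by auto
  have aK: "a \<in> mspace K" using T(1) aT openin_subset by fastforce
  \<comment> \<open>This makes the largest candidate radius
    \<open>(4 * real n + 1) * \<delta>\<close> smaller than \<open>r\<close>.\<close>
  define \<delta> where "\<delta> = r / (4 * real n + 2)"
  have \<delta>: "0 < \<delta>" "(4 * real n + 2) * \<delta> = r" unfolding \<delta>_def using r(1) by (auto simp: add_nonneg_pos)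
  have \<delta>r: "(4 * real n + 1) * \<delta> < r" "\<delta> < r"
  proof -
    have "r = (4 * real n + 1) * \<delta> + \<delta>" using \<delta>(2) by (simp add: algebra_simps)
    then show "(4 * real n + 1) * \<delta> < r" using \<delta>(1) by simp
    have "r = 4 * (real n * \<delta>) + 2 * \<delta>" using \<delta>(2) by (simp add: algebra_simps)
    moreover have "0 \<le> real n * \<delta>" using \<delta>(1) by simp
    ultimately show "\<delta> < r" using \<delta>(1) by linarith
  qed
  obtain \<T> \<A> where TA: "finite \<T>" "pairwise disjnt \<T>" "finite \<A>" "card \<A> \<le> n"
      "\<forall>S\<in>\<T> \<union> \<A>. closedin X S \<and> (\<forall>x\<in>S. \<forall>y\<in>S. mdist K x y \<le> \<delta>)" "Z \<subseteq> \<Union>\<T> \<union> \<Union>\<A>"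
    using assms[OF \<delta>(1)] by (elim exE conjE)
  define \<T>' where "\<T>' = {S\<in>\<T>. \<forall>A\<in>\<A>. S \<inter> A = {}}"
  \<comment> \<open>A star has diameter at most \<open>3 * \<delta>\<close>. The members of
    \<open>\<T>\<close> that meet no set of \<open>\<A>\<close> are disjoint from all stars and from
    each other.\<close>
  define star where "star A = A \<union> \<Union>{S\<in>\<T>. S \<inter> A \<noteq> {}}" for A
  define B where "B = \<Union>(star ` \<A>)"
  have clo: "closedin X S" if "S \<in> \<T> \<union> \<A>" for S using TA(5) that by blast
  have sub: "S \<subseteq> mspace K" if "S \<in> \<T> \<union> \<A>" for S using clo[OF that] closedin_subset by fastforce
  have starc: "closedin X (star A)" if "A \<in> \<A>" for A
    unfolding star_def using clo that TA(1) by (intro closedin_Un closedin_Union) auto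
  have Bc: "closedin X B" unfolding B_def using starc TA(3) by (intro closedin_Union) auto
  have ZB: "Z \<subseteq> B \<union> \<Union>\<T>'"
  proof
    fix x assume "x \<in> Z"
    then consider A where "A \<in> \<A>" "x \<in> A" | S where "S \<in> \<T>" "x \<in> S" using TA(6) by blast
    then show "x \<in> B \<union> \<Union>\<T>'"
    proof cases
      case 1
      then show ?thesis unfolding B_def star_def by blast
    next
      case 2
      then show ?thesis unfolding B_def star_def \<T>'_def by blast
    qed
  qed
  have BT: "B \<inter> S = {}" if S: "S \<in> \<T>'" for S
  proof -
    have "S' \<inter> S = {}" if "S' \<in> \<T>" "S' \<inter> A \<noteq> {}" "A \<in> \<A>" for S' A
    proof -
      have "S' \<noteq> S" using S that unfolding \<T>'_def by blast
      then show ?thesis using TA(2) that(1) S unfolding \<T>'_def pairwise_def disjnt_def by blast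
    qed
    moreover have "A \<inter> S = {}" if "A \<in> \<A>" for A using S that unfolding \<T>'_def by blast
    ultimately show ?thesis unfolding B_def star_def by blast
  qed
  \<comment> \<open>Two disjoint closed sets covering \<open>Z\<close> make
    \<open>C \<inter> Z\<close> relatively clopen, so its frontier is empty, as dimension -1
    requires.\<close>
  have "\<exists>C D. closedin X C \<and> closedin X D \<and> Z \<subseteq> C \<union> D \<and> C \<inter> D = {} \<and> a \<in> C \<and> C \<subseteq> mball a r"
  proof (cases "a \<in> B")
    case False
    then obtain S where S: "S \<in> \<T>'" "a \<in> S" using ZB aT by blast
    have ST: "S \<in> \<T> \<union> \<A>" using S(1) unfolding \<T>'_def by blast
    define D where "D = B \<union> \<Union>(\<T>' - {S})"
    have "closedin X D"
      unfolding D_def using Bc TA(1) clo by (intro closedin_Un closedin_Union) (auto simp: \<T>'_def)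
    moreover have "S \<inter> D = {}"
    proof -
      have "S \<inter> S' = {}" if "S' \<in> \<T>' - {S}" for S'
        using TA(2) S(1) that unfolding \<T>'_def pairwise_def disjnt_def by blast
      then show ?thesis using BT[OF S(1)] unfolding D_def by blast
    qed
    moreover have "Z \<subseteq> S \<union> D" using ZB unfolding D_def by blast
    moreover have "S \<subseteq> mball a r"
    proof
      fix x assume x: "x \<in> S"
      have "mdist K a x \<le> \<delta>" using TA(5) ST S(2) x by blast
      then show "x \<in> mball a r" using aK sub[OF ST] x \<delta>r(2) by auto
    qed
    ultimately show ?thesis using clo[OF ST] S(2) by blast
  next
    case True
    have diam: "\<bar>mdist K a x - mdist K a y\<bar> \<le> 3 * \<delta>" if A': "A' \<in> star ` \<A>" and xy: "x \<in> A'" "y \<in> A'" for A' x y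
    proof -
      obtain A where A: "A \<in> \<A>" "A' = star A" using A' by blast
      have near: "\<exists>u\<in>A. mdist K u z \<le> \<delta> \<and> z \<in> mspace K" if z: "z \<in> star A" for z
      proof (cases "z \<in> A")
        case True
        then show ?thesis using sub[of A] A(1) \<delta>(1) by (intro bexI[of _ z]) auto
      next
        case False
        then obtain S where S: "S \<in> \<T>" "S \<inter> A \<noteq> {}" "z \<in> S" using z unfolding star_def by blast
        then obtain u where u: "u \<in> S" "u \<in> A" by blast
        have "mdist K u z \<le> \<delta>" using TA(5) S u by blast
        then show ?thesis using u S sub[of S] by (intro bexI[of _ u]) auto
      qed
      obtain u where u: "u \<in> A" "mdist K u x \<le> \<delta>" "x \<in> mspace K" using near xy A(2) by blast
      obtain v where v: "v \<in> A" "mdist K v y \<le> \<delta>" "y \<in> mspace K" using near xy A(2) by blast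
      have uv: "u \<in> mspace K" "v \<in> mspace K" using u v A(1) sub[of A] by auto
      have "mdist K u v \<le> \<delta>" using TA(5) A(1) u v by blast
      moreover have "mdist K x y \<le> mdist K x u + mdist K u v + mdist K v y"
        using mdist_triangle[OF u(3) uv(1) v(3)] mdist_triangle[OF uv v(3)] by simp
      ultimately have "mdist K x y \<le> 3 * \<delta>" using u v commute[of x u] by simp
      then show ?thesis
        using mdist_triangle[OF aK u(3) v(3)] mdist_triangle[OF aK v(3) u(3)] commute[of x y] by simp
    qed
    have cs: "card (star ` \<A>) \<le> n" using TA(3,4) card_image_le[of \<A> star] by simp
    have fs: "finite (star ` \<A>)" using TA(3) by simp
    obtain t where t: "0 < t" "t \<le> (4 * real n + 1) * \<delta>" "\<forall>x\<in>\<Union>(star ` \<A>). mdist K a x \<noteq> t"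
      by (rule finite_pigeonhole_radius[OF fs cs \<delta>(1) diam])
    \<comment> \<open>The sphere of radius \<open>t\<close> misses \<open>B\<close>, so the closed
      ball and the complement of the open ball split \<open>B\<close> into disjoint closed
      parts.\<close>
    define C where "C = B \<inter> mcball a t"
    define D where "D = (B - mball a t) \<union> \<Union>\<T>'"
    have "closedin X C" unfolding C_def using Bc closedin_mcball[of a t] by (simp add: closedin_Int)
    moreover have "closedin X D"
      unfolding D_def using Bc openin_mball[of a t] TA(1) clo
      by (intro closedin_Un closedin_Union closedin_diff) (auto simp: \<T>'_def)
    moreover have BK: "B \<subseteq> mspace K" using Bc closedin_subset by fastforce
    then have "Z \<subseteq> C \<union> D" using ZB aK unfolding C_def D_def by fastforce
    moreover have "C \<inter> D = {}"
      using BT t(3) BK unfolding C_def D_def B_def[symmetric] by force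
    moreover have "a \<in> C" unfolding C_def using True aK t(1) by auto
    moreover have "C \<subseteq> mball a r" unfolding C_def using t(2) \<delta>r(1) by auto
    ultimately show ?thesis by blast
  qed
  then obtain C D where CD: "closedin X C" "closedin X D" "Z \<subseteq> C \<union> D" "C \<inter> D = {}" "a \<in> C" "C \<subseteq> mball a r"
    by (elim exE conjE)
  define U where "U = C \<inter> Z"
  have tW: "topspace W = mspace K \<inter> Z" unfolding W_def by simp
  have cU: "closedin W U" unfolding U_def W_def closedin_subtopology using CD(1) by blast
  have "closedin W (D \<inter> Z)" unfolding W_def closedin_subtopology using CD(2) by blast
  moreover have "U = topspace W - D \<inter> Z"
    using CD closedin_subset[OF CD(1)] unfolding U_def tW by auto
  ultimately have oU: "openin W U" by (simp add: openin_diff)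
  have "W frontier_of U = {}" using cU oU frontier_of_eq_empty[of U W] closedin_subset by blast
  then have "subtopology W (W frontier_of U) dim_le (0 - 1)" by simp
  moreover have "U \<subseteq> V" using CD(6) r(2) T(2) unfolding U_def by blast
  ultimately show "\<exists>U. a \<in> U \<and> U \<subseteq> V \<and> openin (subtopology X Z) U \<and>
      subtopology (subtopology X Z) (subtopology X Z frontier_of U) dim_le (0 - 1)"
    using oU CD(5) aT unfolding W_def U_def by blast
qed simp

text \<open>Sets are added one at a time, blending in the new value with a Urysohn function that is
  1 on the new set and 0 on the old ones.\<close>

lemma continuous_map_prescribed:
  assumes "finite \<S>" "pairwise disjnt \<S>" "\<And>S. S \<in> \<S> \<Longrightarrow> closedin X S"
  shows "\<exists>u. continuous_map X euclideanreal u \<and> (\<forall>S\<in>\<S>. \<forall>x\<in>S. u x = v S)"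
  using assms
proof (induction \<S> rule: finite_induct)
  case empty
  then show ?case by (intro exI[of _ "\<lambda>_. 0"]) auto
next
  case (insert S \<S>)
  then obtain u where u: "continuous_map X euclideanreal u" "\<forall>S\<in>\<S>. \<forall>x\<in>S. u x = v S"
    by (auto simp: pairwise_insert)
  have d: "disjnt S (\<Union>\<S>)" using insert.prems(1) insert.hyps(2) unfolding pairwise_insert disjnt_def by blast
  have c: "closedin X S" "closedin X (\<Union>\<S>)"
    using insert.prems(2) insert.hyps(1) by (auto intro: closedin_Union)
  obtain \<phi> where \<phi>: "continuous_map X euclideanreal \<phi>" "\<phi> ` S \<subseteq> {1}" "\<phi> ` (\<Union>\<S>) \<subseteq> {0}"
    by (rule Urysohn_lemma_alt[OF normal c d])
  have "u x * (1 - \<phi> x) + v S' * \<phi> x = v S'" if "x \<in> S'" "S' = S" for x S'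
  proof -
    have "\<phi> x = 1" using that \<phi>(2) by auto
    then show ?thesis by simp
  qed
  moreover have "u x * (1 - \<phi> x) + v S * \<phi> x = v S'" if "x \<in> S'" "S' \<in> \<S>" for x S'
  proof -
    have "\<phi> x = 0" using that \<phi>(3) by blast
    then show ?thesis using u(2) that by simp
  qed
  ultimately show ?case
    by (intro exI[of _ "\<lambda>x. u x * (1 - \<phi> x) + v S * \<phi> x"] conjI)
      (auto intro!: continuous_map_add continuous_map_diff continuous_map_real_mult u(1) \<phi>(1))
qed


text \<open>For each scale, having \<open>n + 1\<close> small families of which \<open>n\<close> are
  separated by the coordinates is an open dense condition. On a fibre the separated families
  contribute at most \<open>n\<close> sets, and \<open>zero_dim_criterion\<close> applies.\<close>

lemma generic_zero_dim_fibres: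
  assumes Z: "closedin X Z" "subtopology X Z dim_le int CARD('n::finite)"
  shows "\<exists>\<P> :: (('a \<Rightarrow> real ^ 'n) \<Rightarrow> bool) set. countable \<P> \<and> (\<forall>P\<in>\<P>. sup_open X P \<and> sup_dense X P) \<and>
    (\<forall>f. (\<forall>P\<in>\<P>. P f) \<longrightarrow> (\<forall>y. subtopology X {x\<in>Z. f x = y} dim_le 0))"
proof -
  let ?n = "CARD('n)"
  obtain \<iota> :: "'n \<Rightarrow> nat" where \<iota>: "bij_betw \<iota> UNIV {0..<?n}"
    using ex_bij_betw_finite_nat[of "UNIV :: 'n set"] by auto
  then have \<iota>n: "\<iota> c < ?n" for c using bij_betwE by fastforce
  define fam where "fam \<delta> \<S> \<longleftrightarrow> (\<forall>i<Suc ?n. finite (\<S> i) \<and> pairwise disjnt (\<S> i) \<and>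
             (\<forall>S\<in>\<S> i. closedin X S \<and> (\<forall>x\<in>S. \<forall>y\<in>S. mdist K x y \<le> \<delta>))) \<and>
      Z \<subseteq> (\<Union>i<Suc ?n. \<Union>(\<S> i))" for \<delta> :: real and \<S> :: "nat \<Rightarrow> 'a set set"
  have famD: "finite (\<S> i)" "pairwise disjnt (\<S> i)" "\<And>S. S \<in> \<S> i \<Longrightarrow> closedin X S"
      "\<And>S x y. S \<in> \<S> i \<Longrightarrow> x \<in> S \<Longrightarrow> y \<in> S \<Longrightarrow> mdist K x y \<le> \<delta>"
    if "fam \<delta> \<S>" "i < Suc ?n" for \<delta> \<S> i
    using that(1)[unfolded fam_def, THEN conjunct1, rule_format, OF that(2)] by auto
  \<comment> \<open>A uniform gap \<open>r\<close>, rather than mere distinctness of values, lets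
    the condition survive perturbations below \<open>r/3\<close>.\<close>
  define sep where "sep r \<S> f \<longleftrightarrow> (\<forall>c. \<forall>S\<in>\<S> (\<iota> c). \<forall>S'\<in>\<S> (\<iota> c). S \<noteq> S' \<longrightarrow>
      (\<forall>x\<in>S. \<forall>y\<in>S'. r \<le> \<bar>f x $ c - f y $ c\<bar>))" for r :: real and \<S> and f :: "'a \<Rightarrow> real ^ 'n"
  define W where "W \<delta> f \<longleftrightarrow> (\<exists>\<S> r. 0 < r \<and> fam \<delta> \<S> \<and> sep r \<S> f)" for \<delta> f
  have op: "sup_open X (W \<delta>)" for \<delta>
    unfolding sup_open_def
  proof (intro allI impI, elim conjE)
    fix f assume "continuous_map X euclidean f" "W \<delta> f"
    then obtain \<S> r where S: "0 < r" "fam \<delta> \<S>" "sep r \<S> f" unfolding W_def by blast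
    show "\<exists>e>0. \<forall>g. continuous_map X euclidean g \<and> (\<forall>x\<in>topspace X. dist (g x) (f x) \<le> e) \<longrightarrow> W \<delta> g"
    proof (intro exI[of _ "r/3"] conjI allI impI, goal_cases)
      case 1
      then show ?case using S by simp
    next
      case (2 g)
      have "sep (r/3) \<S> g"
        unfolding sep_def
      proof (intro allI ballI impI)
        fix c S S' x y assume h: "S \<in> \<S> (\<iota> c)" "S' \<in> \<S> (\<iota> c)" "S \<noteq> S'" "x \<in> S" "y \<in> S'"
        have "closedin X S" "closedin X S'"
          using famD(3)[OF S(2), of "\<iota> c"] h(1,2) \<iota>n[of c] by simp_all
        then have "x \<in> topspace X" "y \<in> topspace X" using h closedin_subset by blast+
        then have "dist (g x) (f x) \<le> r/3" "dist (g y) (f y) \<le> r/3" using 2 by blast+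
        then have "\<bar>g x $ c - f x $ c\<bar> \<le> r/3" "\<bar>g y $ c - f y $ c\<bar> \<le> r/3"
          using component_le_norm_cart[of "g x - f x" c] component_le_norm_cart[of "g y - f y" c]
          unfolding dist_norm by auto
        moreover have "r \<le> \<bar>f x $ c - f y $ c\<bar>" using S(3) h unfolding sep_def by blast
        ultimately show "r/3 \<le> \<bar>g x $ c - g y $ c\<bar>" by linarith
      qed
      then show ?case unfolding W_def using S by (intro exI[of _ \<S>] exI[of _ "r/3"]) auto
    qed
  qed
  have de: "sup_dense X (W \<delta>)" if \<delta>: "0 < \<delta>" for \<delta>
    unfolding sup_dense_def
  proof (intro allI impI, elim conjE)
    fix f :: "'a \<Rightarrow> real ^ 'n" and e :: real
    assume f: "continuous_map X euclidean f" and e: "0 < e"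
    \<comment> \<open>Each of the \<open>n\<close> coordinates will move by at most
      \<open>2 * e'\<close>, hence the map by at most \<open>e\<close>.\<close>
    define e' where "e' = e / (2 * real ?n)"
    have e': "0 < e'" "real ?n * (2 * e') = e" unfolding e'_def using e by auto
    obtain \<eta> where \<eta>: "0 < \<eta>" "\<And>x y. x \<in> mspace K \<Longrightarrow> y \<in> mspace K \<Longrightarrow> mdist K x y < \<eta> \<Longrightarrow> dist (f x) (f y) < e'"
      using uniformly_continuous[OF f e'(1)] by auto
    have m: "0 < min \<delta> (\<eta>/2)" using \<delta> \<eta>(1) by simp
    have Zd: "subtopology X Z dim_le (int (Suc ?n) - 1)" using Z(2) by simp
    obtain \<S> where S0: "fam (min \<delta> (\<eta>/2)) \<S>"
      using small_disjoint_families[OF Z(1) Zd m] unfolding fam_def by blast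
    then have S: "fam \<delta> \<S>" unfolding fam_def by (simp add: min_def split: if_splits) fastforce
    have fin: "finite (\<S> (\<iota> c))" and disj: "pairwise disjnt (\<S> (\<iota> c))"
      and clo: "\<And>S. S \<in> \<S> (\<iota> c) \<Longrightarrow> closedin X S" for c
      using famD(1-3)[OF S, of "\<iota> c"] \<iota>n[of c] by simp_all
    have small: "\<bar>f x $ c - f y $ c\<bar> \<le> e'" if "S \<in> \<S> (\<iota> c)" "x \<in> S" "y \<in> S" for c S x y
    proof -
      have "mdist K x y \<le> min \<delta> (\<eta>/2)" using famD(4)[OF S0, of "\<iota> c"] that \<iota>n[of c] by simp
      then have "mdist K x y < \<eta>" using \<eta>(1) by auto
      moreover have "x \<in> mspace K" "y \<in> mspace K" using clo that closedin_subset by fastforce+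
      ultimately have "dist (f x) (f y) < e'" using \<eta>(2) by blast
      then show ?thesis using component_le_norm_cart[of "f x - f y" c] unfolding dist_norm by simp
    qed
    \<comment> \<open>Distinct values close to \<open>f\<close> are assigned to the members of each
      family. The sample point is arbitrary if \<open>S\<close> is empty, but then the value is
      attained nowhere.\<close>
    define R where "R c w \<longleftrightarrow> inj_on w (\<S> (\<iota> c)) \<and> (\<forall>S\<in>\<S> (\<iota> c). \<bar>w S - f (SOME x. x \<in> S) $ c\<bar> \<le> e')" for c w
    have "\<forall>c. \<exists>w. R c w"
      unfolding R_def
    proof
      show "\<exists>w. inj_on w (\<S> (\<iota> c)) \<and> (\<forall>S\<in>\<S> (\<iota> c). \<bar>w S - f (SOME x. x \<in> S) $ c\<bar> \<le> e')" for c
        by (rule finite_injective_approx[OF fin e'(1)])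
    qed
    from choice[OF this] obtain v where "\<forall>c. R c (v c)" ..
    then have v: "inj_on (v c) (\<S> (\<iota> c))" "S \<in> \<S> (\<iota> c) \<Longrightarrow> \<bar>v c S - f (SOME x. x \<in> S) $ c\<bar> \<le> e'" for c S
      unfolding R_def by simp_all
    define R' where "R' c w \<longleftrightarrow> continuous_map X euclideanreal w \<and> (\<forall>S\<in>\<S> (\<iota> c). \<forall>x\<in>S. w x = v c S)" for c w
    have "\<forall>c. \<exists>w. R' c w"
      unfolding R'_def
    proof
      show "\<exists>w. continuous_map X euclideanreal w \<and> (\<forall>S\<in>\<S> (\<iota> c). \<forall>x\<in>S. w x = v c S)" for c
        by (rule continuous_map_prescribed[OF fin disj clo])
    qed
    from choice[OF this] obtain u where "\<forall>c. R' c (u c)" ..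
    then have u: "continuous_map X euclideanreal (u c)" "S \<in> \<S> (\<iota> c) \<Longrightarrow> x \<in> S \<Longrightarrow> u c x = v c S" for c S x
      unfolding R'_def by simp_all
    \<comment> \<open>On a member \<open>S\<close> the prescribed value is within \<open>e'\<close>
      of \<open>f\<close> at the sample point, and \<open>f\<close> varies by at most
      \<open>e'\<close> on \<open>S\<close>; so the clamp is inactive and \<open>g\<close> takes the
      prescribed value.\<close>
    define g where "g x = (\<chi> c. nudge (2 * e') (f x $ c) (u c x))" for x
    have fc: "continuous_map X euclideanreal (\<lambda>x. f x $ c)" for c using f continuous_map_vec by blast
    have gc: "continuous_map X euclidean g"
      unfolding continuous_map_vec g_def using fc u(1) by (auto intro!: continuous_map_nudge)
    have gv: "g x $ c = v c S" if "S \<in> \<S> (\<iota> c)" "x \<in> S" for c S x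
    proof -
      have "(SOME x. x \<in> S) \<in> S" using that(2) by (rule someI)
      then have "\<bar>f x $ c - f (SOME x. x \<in> S) $ c\<bar> \<le> e'" using small that by blast
      moreover have "\<bar>v c S - f (SOME x. x \<in> S) $ c\<bar> \<le> e'" using v(2) that by blast
      ultimately have "\<bar>v c S - f x $ c\<bar> \<le> 2 * e'" by linarith
      moreover have "u c x = v c S" using u(2) that by blast
      ultimately show ?thesis unfolding g_def by (simp add: nudge_eq)
    qed
    define Pr where "Pr = (\<Union>c. {(c, S, S') |S S'. S \<in> \<S> (\<iota> c) \<and> S' \<in> \<S> (\<iota> c) \<and> S \<noteq> S'})"
    have "\<exists>r>0. \<forall>p\<in>Pr. r \<le> \<bar>v (fst p) (fst (snd p)) - v (fst p) (snd (snd p))\<bar>"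
    proof (rule finite_common_radius)
      have "Pr \<subseteq> (\<Union>c. {c} \<times> \<S> (\<iota> c) \<times> \<S> (\<iota> c))" unfolding Pr_def by auto
      then show "finite Pr" by (rule finite_subset) (use fin in auto)
      fix p assume "p \<in> Pr"
      then obtain c S S' where p: "p = (c, S, S')" "S \<in> \<S> (\<iota> c)" "S' \<in> \<S> (\<iota> c)" "S \<noteq> S'" unfolding Pr_def by blast
      have "v c S \<noteq> v c S'" using p inj_onD[OF v(1), of c S S'] by blast
      then show "\<exists>r>0. r \<le> \<bar>v (fst p) (fst (snd p)) - v (fst p) (snd (snd p))\<bar>"
        using p by (intro exI[of _ "\<bar>v c S - v c S'\<bar>"]) auto
    qed auto
    then obtain r where r: "0 < r" "\<And>p. p \<in> Pr \<Longrightarrow> r \<le> \<bar>v (fst p) (fst (snd p)) - v (fst p) (snd (snd p))\<bar>" by blast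
    have "sep r \<S> g"
      unfolding sep_def
    proof (intro allI ballI impI)
      fix c S S' x y assume h: "S \<in> \<S> (\<iota> c)" "S' \<in> \<S> (\<iota> c)" "S \<noteq> S'" "x \<in> S" "y \<in> S'"
      then have "(c, S, S') \<in> Pr" unfolding Pr_def by blast
      then show "r \<le> \<bar>g x $ c - g y $ c\<bar>" using r(2) gv h by fastforce
    qed
    then have "W \<delta> g" unfolding W_def using r(1) S by blast
    moreover have "dist (g x) (f x) \<le> e" for x
      using dist_vec_le[of "g x" "f x" "2 * e'"] nudge_close[of "2 * e'"] e' unfolding g_def by simp
    ultimately show "\<exists>g. continuous_map X euclidean g \<and> (\<forall>x\<in>topspace X. dist (g x) (f x) \<le> e) \<and> W \<delta> g"
      using gc by blast
  qed
  have main: "subtopology X {x\<in>Z. f x = y} dim_le 0" if f: "\<forall>P\<in>(\<lambda>i. W (inverse (Suc i))) ` UNIV. P f" for f y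
  proof (rule zero_dim_criterion[where n = ?n])
    fix \<delta> :: real assume "0 < \<delta>"
    then obtain i where i: "inverse (Suc i) < \<delta>" using reals_Archimedean by blast
    have "W (inverse (Suc i)) f" using f by blast
    then obtain \<S> r where S: "0 < r" "fam (inverse (Suc i)) \<S>" "sep r \<S> f" unfolding W_def by blast
    \<comment> \<open>Separation leaves at most one member per coordinate that meets the fibre.
      Family number \<open>n\<close>, which belongs to no coordinate, serves as the disjoint family
      of the criterion.\<close>
    define A where "A c = {S\<in>\<S> (\<iota> c). \<exists>x\<in>S. f x = y}" for c
    have "finite (A c) \<and> card (A c) \<le> 1" for c
    proof -
      have eq: "S = S'" if SA: "S \<in> A c" "S' \<in> A c" for S S'
      proof (rule ccontr)
        assume "S \<noteq> S'"
        moreover obtain x x' where "x \<in> S" "f x = y" "x' \<in> S'" "f x' = y" using SA unfolding A_def by blast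
        ultimately have "r \<le> \<bar>f x $ c - f x' $ c\<bar>" using S(3) SA unfolding sep_def A_def by blast
        then show False using \<open>f x = y\<close> \<open>f x' = y\<close> S(1) by simp
      qed
      have "finite (A c)" unfolding A_def using famD(1)[OF S(2), of "\<iota> c"] \<iota>n[of c] by simp
      moreover have "card (A c) \<le> Suc 0" using eq \<open>finite (A c)\<close> by (subst card_le_Suc0_iff_eq) auto
      ultimately show ?thesis by simp
    qed
    then have cA: "finite (A c)" "card (A c) \<le> 1" for c by auto
    have "card (\<Union>c. A c) \<le> (\<Sum>c\<in>UNIV. card (A c))" by (rule card_UN_le) simp
    also have "\<dots> \<le> (\<Sum>c\<in>(UNIV::'n set). 1)" by (rule sum_mono) (use cA in auto)
    finally have card: "card (\<Union>c. A c) \<le> ?n" by simp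
    have cov: "{x \<in> Z. f x = y} \<subseteq> \<Union>(\<S> ?n) \<union> \<Union>(\<Union>c. A c)"
    proof
      fix x assume x: "x \<in> {x \<in> Z. f x = y}"
      then obtain j S' where j: "j < Suc ?n" "S' \<in> \<S> j" "x \<in> S'" using S(2) unfolding fam_def by blast
      show "x \<in> \<Union>(\<S> ?n) \<union> \<Union>(\<Union>c. A c)"
      proof (cases "j = ?n")
        case False
        then have "j \<in> {0..<?n}" using j by simp
        then have "j \<in> \<iota> ` UNIV" using \<iota> by (simp add: bij_betw_def)
        then obtain c where "j = \<iota> c" by blast
        then have "S' \<in> A c" unfolding A_def using j x by blast
        then show ?thesis using j by blast
      qed (use j in blast)
    qed
    have Sp: "closedin X S'" "\<forall>x\<in>S'. \<forall>y\<in>S'. mdist K x y \<le> \<delta>" if S': "S' \<in> \<S> ?n \<union> (\<Union>c. A c)" for S'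
    proof -
      obtain j where "j < Suc ?n" "S' \<in> \<S> j"
      proof (cases "S' \<in> \<S> ?n")
        case False
        then obtain c where "S' \<in> \<S> (\<iota> c)" using S' unfolding A_def by blast
        then show thesis using that[of "\<iota> c"] \<iota>n[of c] by simp
      qed (use that[of ?n] in simp)
      then have "closedin X S'" "\<forall>x\<in>S'. \<forall>y\<in>S'. mdist K x y \<le> inverse (Suc i)"
        using famD(3,4)[OF S(2), of j] by simp_all
      then show "closedin X S'" "\<forall>x\<in>S'. \<forall>y\<in>S'. mdist K x y \<le> \<delta>" using i by fastforce+
    qed
    have fS: "finite (\<S> ?n)" "pairwise disjnt (\<S> ?n)" using famD(1,2)[OF S(2), of ?n] by simp_all
    have fA: "finite (\<Union>c. A c)" using cA(1) by (intro finite_UN_I) auto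
    show "\<exists>\<T> \<A>. finite \<T> \<and> pairwise disjnt \<T> \<and> finite \<A> \<and> card \<A> \<le> ?n \<and>
      (\<forall>S\<in>\<T> \<union> \<A>. closedin X S \<and> (\<forall>x\<in>S. \<forall>y\<in>S. mdist K x y \<le> \<delta>)) \<and> {x \<in> Z. f x = y} \<subseteq> \<Union>\<T> \<union> \<Union>\<A>"
      using fS fA card Sp cov by (intro exI[of _ "\<S> ?n"] exI[of _ "\<Union>c. A c"] conjI ballI) simp_all
  qed
  show ?thesis
  proof (intro exI[of _ "(\<lambda>i. W (inverse (Suc i))) ` (UNIV :: nat set)"] conjI)
    show "\<forall>P\<in>(\<lambda>i. W (inverse (real (Suc i)))) ` UNIV. sup_open X P \<and> sup_dense X P"
      using op de by auto
  qed (use main in auto)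
qed

section \<open>Upper bound for all fibres of a generic map\<close>

text \<open>A countable base of \<open>Z\<close> has frontiers of dimension one less, and by
  induction generic fibres inside them have dimension at most \<open>k\<close>; hence fibres in
  \<open>Z\<close> have dimension at most \<open>k + 1\<close>. Keeping the set \<open>\<P>\<close>
  of conditions allows the countably many frontiers to be treated together.\<close>

lemma generic_fibre_dim_le:
  "closedin X Z \<Longrightarrow> subtopology X Z dim_le (int CARD('n::finite) + int k) \<Longrightarrow>
    \<exists>\<P> :: (('a \<Rightarrow> real ^ 'n) \<Rightarrow> bool) set. countable \<P> \<and> (\<forall>P\<in>\<P>. sup_open X P \<and> sup_dense X P) \<and>
    (\<forall>f. (\<forall>P\<in>\<P>. P f) \<longrightarrow> (\<forall>y. subtopology X {x\<in>Z. f x = y} dim_le int k))"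
proof (induction k arbitrary: Z)
  case 0
  then show ?case using generic_zero_dim_fibres[where 'n='n] by simp
next
  case (Suc k)
  obtain \<U> where U: "countable \<U>" "\<forall>U\<in>\<U>. openin (subtopology X Z) U"
    "\<forall>U\<in>\<U>. closedin X (subtopology X Z frontier_of U)"
    "\<forall>U\<in>\<U>. subtopology X (subtopology X Z frontier_of U) dim_le (int CARD('n) + int (Suc k) - 1)"
    "\<forall>V x. openin (subtopology X Z) V \<and> x \<in> V \<longrightarrow> (\<exists>U\<in>\<U>. x \<in> U \<and> U \<subseteq> V)"
    by (rule countable_frontier_base[OF Suc.prems(1,2)])
  have "\<forall>U\<in>\<U>. \<exists>\<P> :: (('a \<Rightarrow> real ^ 'n) \<Rightarrow> bool) set. countable \<P> \<and> (\<forall>P\<in>\<P>. sup_open X P \<and> sup_dense X P) \<and>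
    (\<forall>f. (\<forall>P\<in>\<P>. P f) \<longrightarrow> (\<forall>y. subtopology X {x\<in>subtopology X Z frontier_of U. f x = y} dim_le int k))"
  proof
    fix U assume "U \<in> \<U>"
    then have "closedin X (subtopology X Z frontier_of U)"
        "subtopology X (subtopology X Z frontier_of U) dim_le (int CARD('n) + int k)"
      using U(3,4) by auto
    then show "\<exists>\<P> :: (('a \<Rightarrow> real ^ 'n) \<Rightarrow> bool) set. countable \<P> \<and> (\<forall>P\<in>\<P>. sup_open X P \<and> sup_dense X P) \<and>
    (\<forall>f. (\<forall>P\<in>\<P>. P f) \<longrightarrow> (\<forall>y. subtopology X {x\<in>subtopology X Z frontier_of U. f x = y} dim_le int k))"
      by (rule Suc.IH)
  qed
  from bchoice[OF this] obtain p :: "'a set \<Rightarrow> (('a \<Rightarrow> real ^ 'n) \<Rightarrow> bool) set"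
    where p: "\<forall>U\<in>\<U>. countable (p U) \<and> (\<forall>P\<in>p U. sup_open X P \<and> sup_dense X P) \<and>
    (\<forall>f. (\<forall>P\<in>p U. P f) \<longrightarrow> (\<forall>y. subtopology X {x\<in>subtopology X Z frontier_of U. f x = y} dim_le int k))" ..
  have "subtopology X {x\<in>Z. f x = y} dim_le int (Suc k)" if f: "\<forall>P\<in>(\<Union>U\<in>\<U>. p U). P f" for f y
  proof (rule dim_le_of_base[where Z=Z and \<U>=\<U>])
    fix U assume UU: "U \<in> \<U>"
    show "openin (subtopology X Z) U" using U(2) UU by blast
    have "subtopology X {x\<in>subtopology X Z frontier_of U. f x = y} dim_le int k" using p UU f by blast
    then have "subtopology X ({x\<in>Z. f x = y} \<inter> subtopology X Z frontier_of U) dim_le int k"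
      by (rule dimension_le_subtopologies) auto
    then show "subtopology X ({x\<in>Z. f x = y} \<inter> subtopology X Z frontier_of U) dim_le (int (Suc k) - 1)" by simp
  qed (use U(5) in auto)
  moreover have "countable (\<Union>U\<in>\<U>. p U)" using U(1) p by blast
  ultimately show ?case using p by (intro exI[of _ "\<Union>U\<in>\<U>. p U"]) blast
qed


subsection \<open>Stable fibres\<close>

text \<open>Finitely many balls of radius \<open>r\<close> cover the space. If all were avoidable,
  so would be their union, and the dimension would be too small.\<close>

lemma not_avoidable_small_ball:
  assumes "\<not> X dim_le (int m - 1)" "0 < r"
  obtains p where "p \<in> mspace K" "\<not> avoidable m (mcball p r)"
proof -
  have "mtotally_bounded (mspace K)"
    using compact compactin_imp_mtotally_bounded[of "mspace K"] by (simp add: compact_space_def)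
  from this[unfolded mtotally_bounded_def, rule_format, OF assms(2)]
  obtain C where C: "finite C" "C \<subseteq> mspace K" "mspace K \<subseteq> (\<Union>x\<in>C. mball x r)"
    by (elim exE conjE)
  note that0 = that
  show thesis
  proof (rule ccontr)
    assume n: "\<not> thesis"
    have "avoidable m (mcball p r)" if "p \<in> C" for p
    proof (rule ccontr)
      assume "\<not> avoidable m (mcball p r)"
      with \<open>p \<in> C\<close> C(2) have thesis by (intro that0) auto
      then show False using n by simp
    qed
    moreover have "\<And>p. closedin X (mcball p r)" using closedin_mcball by simp
    ultimately have "avoidable m (\<Union>p\<in>C. mcball p r)" by (intro avoidable_UN C(1))
    moreover have "(\<Union>p\<in>C. mball p r) \<subseteq> (\<Union>p\<in>C. mcball p r)"
      by (intro UN_mono mball_subset_mcball) simp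
    then have "topspace X \<subseteq> (\<Union>p\<in>C. mcball p r)" using C(3) by simp
    ultimately have "avoidable m (topspace X)" by (rule avoidable_mono)
    then have "subtopology X (topspace X) dim_le (int m - 1)"
      by (rule avoidable_imp_dim_le[OF closedin_topspace])
    then show False using assms(1) by (simp only: subtopology_topspace)
  qed
qed

lemma continuous_functions_bounded:
  fixes k :: nat
  assumes "\<And>i. i < k \<Longrightarrow> continuous_map X euclideanreal (h i)"
  obtains M where "0 < M" "\<forall>i<k. \<forall>x\<in>topspace X. \<bar>h i x\<bar> \<le> M"
proof -
  have "\<exists>M>0. \<forall>i<k. \<forall>x\<in>topspace X. \<bar>h i x\<bar> \<le> M"
    using assms
  proof (induction k)
    case 0
    then show ?case by (intro exI[of _ 1]) simp
  next
    case (Suc k)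
    then obtain M where M: "0 < M" "\<forall>i<k. \<forall>x\<in>topspace X. \<bar>h i x\<bar> \<le> M" by auto
    have "compact (h k ` topspace X)"
      using image_compactin[OF closedin_imp_compactin[OF closedin_topspace] Suc.prems[OF lessI]] by simp
    then have "bounded (h k ` topspace X)" by (rule compact_imp_bounded)
    then obtain N where N: "\<forall>y\<in>h k ` topspace X. \<bar>y\<bar> \<le> N"
      unfolding bounded_real ..
    show ?case
    proof (intro exI[of _ "max M N"] conjI allI impI ballI)
      show "\<bar>h i x\<bar> \<le> max M N" if "i < Suc k" "x \<in> topspace X" for i x
      proof (cases "i = k")
        case True
        then have "\<bar>h i x\<bar> \<le> N" using N that(2) by blast
        then show ?thesis by simp
      next
        case False
        then have "\<bar>h i x\<bar> \<le> M" using M(2) that by simp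
        then show ?thesis by simp
      qed
    qed (use M in simp)
  qed
  then show thesis using that by blast
qed

text \<open>Demanding the bound for all nearby maps makes the property open. It also allows
  \<open>f\<close> to be moved off \<open>c\<close> on an F-sigma set without losing the large fibre
  over \<open>c\<close>.\<close>

definition stable :: "nat \<Rightarrow> ('a \<Rightarrow> 'b::metric_space) \<Rightarrow> 'b \<Rightarrow> real \<Rightarrow> bool"
  where "stable k f c \<eta> \<longleftrightarrow> 0 < \<eta> \<and>
    (\<forall>h y. continuous_map X euclidean h \<and> (\<forall>x\<in>topspace X. dist (h x) (f x) \<le> \<eta>) \<and> dist y c \<le> \<eta> \<longrightarrow>
      \<not> subtopology X {x\<in>topspace X. h x = y} dim_le (int k - 1))"

text \<open>On a small ball \<open>Z\<close> where \<open>f\<close> is nearly constant,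
  \<open>g\<close> is set to \<open>f p\<close> plus a small multiple of the first \<open>n\<close>
  coordinates of a map \<open>h\<close> with an irremovable zero. A fibre of dimension below
  \<open>k\<close> would allow the last \<open>k\<close> coordinates of \<open>h\<close> to be freed
  of zeros on it, and together with the nearby map itself this would remove the zero of
  \<open>h\<close>.\<close>

lemma stable_dense:
  fixes f :: "'a \<Rightarrow> real ^ 'n"
  assumes dim: "\<not> X dim_le (int CARD('n::finite) + int k - 1)"
    and f: "continuous_map X euclidean f" and e: "0 < e"
  obtains g c \<eta> where "continuous_map X euclidean g" "\<forall>x\<in>topspace X. dist (g x) (f x) \<le> e" "stable k g c \<eta>"
proof -
  let ?n = "CARD('n)"
  obtain \<iota> :: "'n \<Rightarrow> nat" where \<iota>: "bij_betw \<iota> UNIV {0..<?n}"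
    using ex_bij_betw_finite_nat[of "UNIV :: 'n set"] by auto
  then have \<iota>n: "\<iota> j < ?n" for j using bij_betwE by fastforce
  define \<kappa> where "\<kappa> = inv_into UNIV \<iota>"
  have \<kappa>\<iota>: "\<kappa> (\<iota> j) = j" for j
    unfolding \<kappa>_def using \<iota> by (simp add: bij_betw_def)
  define e' where "e' = e / (2 * real ?n)"
  have e': "0 < e'" "real ?n * (2 * e') = e" unfolding e'_def using e by auto
  obtain r where r: "0 < r" "\<And>x y. x \<in> mspace K \<Longrightarrow> y \<in> mspace K \<Longrightarrow> mdist K x y < r \<Longrightarrow> dist (f x) (f y) < e'"
    using uniformly_continuous[OF f e'(1)] by auto
  have r2: "0 < r/2" using r by simp
  have dim': "\<not> X dim_le (int (?n + k) - 1)" using dim by simp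
  obtain p where p: "p \<in> mspace K" "\<not> avoidable (?n + k) (mcball p (r/2))"
    by (rule not_avoidable_small_ball[OF dim' r2])
  define Z where "Z = mcball p (r/2)"
  have Zc: "closedin X Z" unfolding Z_def using closedin_mcball by simp
  have ZX: "Z \<subseteq> topspace X" using Zc closedin_subset by blast
  have fZ: "\<bar>f x $ j - f p $ j\<bar> \<le> e'" if "x \<in> Z" for x j
  proof -
    have "dist (f p) (f x) < e'" using r that unfolding Z_def by auto
    then show ?thesis using component_le_norm_cart[of "f x - f p" j] unfolding dist_norm
      by (simp add: norm_minus_commute)
  qed
  have "\<exists>h \<epsilon>. (\<forall>i<?n+k. continuous_map X euclideanreal (h i)) \<and> 0 < \<epsilon> \<and>
      \<not> (\<exists>g. (\<forall>i<?n+k. continuous_map X euclideanreal (g i) \<and> (\<forall>x\<in>topspace X. \<bar>g i x - h i x\<bar> \<le> \<epsilon>)) \<and>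
           (\<forall>x\<in>Z. \<exists>i<?n+k. g i x \<noteq> 0))"
  proof (rule ccontr)
    assume n: "\<not> ?thesis"
    have "avoidable (?n + k) Z"
    proof (rule avoidableI)
      fix h :: "nat \<Rightarrow> 'a \<Rightarrow> real" and \<epsilon> :: real
      assume "\<And>i. i < ?n+k \<Longrightarrow> continuous_map X euclideanreal (h i)" "0 < \<epsilon>"
      then have "(\<forall>i<?n+k. continuous_map X euclideanreal (h i)) \<and> 0 < \<epsilon>" by simp
      then show "\<exists>g. (\<forall>i<?n+k. continuous_map X euclideanreal (g i) \<and> (\<forall>x\<in>topspace X. \<bar>g i x - h i x\<bar> \<le> \<epsilon>)) \<and>
           (\<forall>x\<in>Z. \<exists>i<?n+k. g i x \<noteq> 0)"
        using n by blast
    qed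
    then show False using p(2) unfolding Z_def by blast
  qed
  then obtain h \<epsilon> where h: "\<forall>i<?n+k. continuous_map X euclideanreal (h i)" "0 < \<epsilon>"
    "\<not> (\<exists>g. (\<forall>i<?n+k. continuous_map X euclideanreal (g i) \<and> (\<forall>x\<in>topspace X. \<bar>g i x - h i x\<bar> \<le> \<epsilon>)) \<and>
           (\<forall>x\<in>Z. \<exists>i<?n+k. g i x \<noteq> 0))"
    by (elim exE conjE)
  have hc: "\<And>i. i < ?n + k \<Longrightarrow> continuous_map X euclideanreal (h i)" using h(1) by blast
  obtain M where M: "0 < M" "\<forall>i<?n+k. \<forall>x\<in>topspace X. \<bar>h i x\<bar> \<le> M"
    by (rule continuous_functions_bounded[OF hc])
  \<comment> \<open>Scaling by \<open>s\<close> makes the added term at most \<open>e'\<close> in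
    each coordinate.\<close>
  define s where "s = e' / M"
  have s: "0 < s" "s * M = e'" unfolding s_def using e'(1) M(1) by auto
  \<comment> \<open>The clamp keeps \<open>g\<close> close to \<open>f\<close> everywhere; on
    \<open>Z\<close> it is inactive.\<close>
  define g where "g x = (\<chi> j. nudge (2 * e') (f x $ j) (f p $ j + s * h (\<iota> j) x))" for x
  have fc: "continuous_map X euclideanreal (\<lambda>x. f x $ j)" for j using f continuous_map_vec by blast
  have gc: "continuous_map X euclidean g"
    unfolding continuous_map_vec g_def
    using fc hc \<iota>n by (auto intro!: continuous_map_nudge continuous_map_add continuous_map_real_mult_left simp: trans_less_add1)
  have gZ: "g x $ j = f p $ j + s * h (\<iota> j) x" if x: "x \<in> Z" for x j
  proof -
    have "\<bar>h (\<iota> j) x\<bar> \<le> M" using M(2) \<iota>n[of j] x ZX by (simp add: subset_iff)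
    then have "\<bar>s * h (\<iota> j) x\<bar> \<le> e'"
      using s mult_left_mono[of "\<bar>h (\<iota> j) x\<bar>" M s] by (simp add: abs_mult)
    then have "\<bar>f p $ j + s * h (\<iota> j) x - f x $ j\<bar> \<le> 2 * e'" using fZ[OF x, of j] by linarith
    then show ?thesis unfolding g_def by (simp add: nudge_eq)
  qed
  \<comment> \<open>The errors of the map and of the value add up to \<open>s * \<epsilon>\<close>,
    which division by \<open>s\<close> turns into the \<open>\<epsilon>\<close> allowed for
    \<open>h\<close>.\<close>
  define \<eta> where "\<eta> = s * \<epsilon> / 2"
  have \<eta>: "0 < \<eta>" unfolding \<eta>_def using s(1) h(2) by simp
  have "stable k g (f p) \<eta>"
    unfolding stable_def
  proof (intro conjI \<eta> allI impI notI, elim conjE)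
    fix u :: "'a \<Rightarrow> real ^ 'n" and y
    assume u: "continuous_map X euclidean u" "\<forall>x\<in>topspace X. dist (u x) (g x) \<le> \<eta>" and y: "dist y (f p) \<le> \<eta>"
      and dim_u: "subtopology X {x \<in> topspace X. u x = y} dim_le (int k - 1)"
    define F where "F = {x \<in> Z. u x = y}"
    have "closedin X F"
      unfolding F_def using closedin_continuous_map_preimage_gen[OF u(1) Zc, of "{y}"] by simp
    moreover have "subtopology X F dim_le (int k - 1)"
      by (rule dimension_le_subtopologies[OF dim_u]) (use ZX F_def in auto)
    ultimately have F: "avoidable k F" by (rule dim_le_imp_avoidable)
    have hk: "\<And>i. i < k \<Longrightarrow> continuous_map X euclideanreal (h (?n + i))" using hc by simp
    obtain w where w: "\<forall>i<k. continuous_map X euclideanreal (w i)"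
      "\<forall>i<k. \<forall>x\<in>topspace X. \<bar>w i x - h (?n + i) x\<bar> \<le> \<epsilon>" "\<forall>x\<in>F. \<exists>i<k. w i x \<noteq> 0"
      by (rule avoidableD[OF F hk h(2)])
    \<comment> \<open>This competitor for \<open>h\<close> reads the first \<open>n\<close>
      coordinates off the nearby map, clamped so that it is within \<open>\<epsilon>\<close> of
      \<open>h\<close> on the whole space. A zero of it in \<open>Z\<close> lies in the fibre
      \<open>F\<close>, where \<open>w\<close> has no zero.\<close>
    define v where "v i x = (if i < ?n then nudge \<epsilon> (h i x) ((u x $ \<kappa> i - y $ \<kappa> i) / s) else w (i - ?n) x)" for i x
    have uc: "continuous_map X euclideanreal (\<lambda>x. u x $ j)" for j using u(1) continuous_map_vec by blast
    have "continuous_map X euclideanreal (v i)" if "i < ?n + k" for i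
    proof (cases "i < ?n")
      case True
      have "continuous_map X euclideanreal (\<lambda>x. (u x $ \<kappa> i - y $ \<kappa> i) / s)"
        using s(1) uc by (intro continuous_map_real_divide continuous_map_diff) auto
      then show ?thesis unfolding v_def using True hc[OF that] by (simp add: continuous_map_nudge)
    next
      case False
      then show ?thesis unfolding v_def using w(1) that by (simp add: fun_eq_iff)
    qed
    moreover have "\<bar>v i x - h i x\<bar> \<le> \<epsilon>" if "i < ?n + k" "x \<in> topspace X" for i x
    proof (cases "i < ?n")
      case True
      then show ?thesis unfolding v_def using h(2) by (simp add: nudge_close)
    next
      case False
      then show ?thesis unfolding v_def using w(2)[rule_format, of "i - ?n" x] that by simp
    qed
    ultimately have "\<not> (\<forall>x\<in>Z. \<exists>i<?n+k. v i x \<noteq> 0)" using h(3) by blast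
    then obtain x where x: "x \<in> Z" "\<And>i. i < ?n + k \<Longrightarrow> v i x = 0" by blast
    have xX: "x \<in> topspace X" using x(1) ZX by blast
    have "u x $ j = y $ j" for j
    proof -
      have "\<bar>u x $ j - g x $ j\<bar> \<le> \<eta>"
        using u(2)[rule_format, OF xX] component_le_norm_cart[of "u x - g x" j] unfolding dist_norm by simp
      moreover have "\<bar>y $ j - f p $ j\<bar> \<le> \<eta>"
        using y component_le_norm_cart[of "y - f p" j] unfolding dist_norm by simp
      ultimately have "\<bar>u x $ j - y $ j - s * h (\<iota> j) x\<bar> \<le> s * \<epsilon>"
        using gZ[OF x(1), of j] unfolding \<eta>_def by linarith
      then have "\<bar>(u x $ j - y $ j) / s - h (\<iota> j) x\<bar> \<le> \<epsilon>"
      proof -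
        assume a: "\<bar>u x $ j - y $ j - s * h (\<iota> j) x\<bar> \<le> s * \<epsilon>"
        have "(u x $ j - y $ j) / s - h (\<iota> j) x = (u x $ j - y $ j - s * h (\<iota> j) x) / s"
          using s(1) by (simp add: field_simps)
        then have "\<bar>(u x $ j - y $ j) / s - h (\<iota> j) x\<bar> = \<bar>u x $ j - y $ j - s * h (\<iota> j) x\<bar> / s"
          using s(1) by simp
        also have "\<dots> \<le> \<epsilon>" using a s(1) by (simp add: divide_le_eq mult.commute)
        finally show ?thesis .
      qed
      then have "v (\<iota> j) x = (u x $ j - y $ j) / s"
        unfolding v_def using \<iota>n[of j] \<kappa>\<iota> by (simp add: nudge_eq)
      moreover have "v (\<iota> j) x = 0" using x(2) \<iota>n[of j] by simp
      ultimately show ?thesis using s(1) by simp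
    qed
    then have "x \<in> F" unfolding F_def using x(1) by (simp add: vec_eq_iff)
    then obtain i where i: "i < k" "w i x \<noteq> 0" using w(3) by blast
    then have "v (?n + i) x \<noteq> 0" unfolding v_def by simp
    then show False using x(2)[of "?n + i"] i(1) by simp
  qed
  moreover have "dist (g x) (f x) \<le> e" for x
    using dist_vec_le[of "g x" "f x" "2 * e'"] nudge_close[of "2 * e'"] e' unfolding g_def by simp
  ultimately show thesis using gc by (intro that[of g "f p" \<eta>]) auto
qed

section \<open>Persistence of stability and avoidance of a value\<close>

lemma sup_open_stable: "sup_open X (\<lambda>f. \<exists>c \<eta>. stable k f c \<eta>)"
  unfolding sup_open_def
proof (intro allI impI, elim conjE exE)
  fix f :: "'a \<Rightarrow> 'b" and c \<eta> assume st: "stable k f c \<eta>"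
  then have \<eta>: "0 < \<eta>" unfolding stable_def by blast
  show "\<exists>e>0. \<forall>g. continuous_map X euclidean g \<and> (\<forall>x\<in>topspace X. dist (g x) (f x) \<le> e) \<longrightarrow> (\<exists>c \<eta>. stable k g c \<eta>)"
  proof (intro exI[of _ "\<eta>/2"] conjI allI impI, goal_cases)
    case 1
    then show ?case using \<eta> by simp
  next
    case (2 g)
    have "stable k g c (\<eta>/2)"
      unfolding stable_def
    proof (intro conjI allI impI, goal_cases)
      case 1
      then show ?case using \<eta> by simp
    next
      case h: (2 h y)
      have "dist (h x) (f x) \<le> \<eta>" if "x \<in> topspace X" for x
      proof -
        have "dist (h x) (g x) \<le> \<eta>/2" "dist (g x) (f x) \<le> \<eta>/2" using h 2 that by blast+
        then show ?thesis using dist_triangle[of "h x" "f x" "g x"] by linarith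
      qed
      moreover have "dist y c \<le> \<eta>" using h \<eta> by auto
      ultimately show ?case using st h unfolding stable_def by blast
    qed
    then show ?case by blast
  qed
qed

text \<open>The coordinates of \<open>f - c\<close> form an \<open>n\<close>-tuple of real
  functions. Density is then avoidability of \<open>C\<close>, and openness is the positive lower
  bound on the compact set \<open>C\<close>.\<close>

lemma generic_avoids_value:
  fixes c :: "real ^ 'n"
  assumes C: "closedin X C" "subtopology X C dim_le (int CARD('n::finite) - 1)"
  shows "sup_open X (\<lambda>f. \<forall>x\<in>C. f x \<noteq> c)" "sup_dense X (\<lambda>f. \<forall>x\<in>C. f x \<noteq> c)"
proof -
  let ?n = "CARD('n)"
  obtain \<iota> :: "'n \<Rightarrow> nat" where \<iota>: "bij_betw \<iota> UNIV {0..<?n}"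
    using ex_bij_betw_finite_nat[of "UNIV :: 'n set"] by auto
  then have \<iota>n: "\<iota> j < ?n" for j using bij_betwE by fastforce
  define \<kappa> where "\<kappa> = inv_into UNIV \<iota>"
  have \<kappa>\<iota>: "\<kappa> (\<iota> j) = j" for j
    unfolding \<kappa>_def using \<iota> by (simp add: bij_betw_def)
  have surj: "\<exists>j. i = \<iota> j" if "i < ?n" for i
    using \<iota> that unfolding bij_betw_def by (metis atLeastLessThan_iff image_iff le0)
  have CX: "C \<subseteq> topspace X" using C(1) closedin_subset by blast
  have comp: "continuous_map X euclideanreal (\<lambda>x. f x $ j - c $ j)" if "continuous_map X euclidean f" for f :: "'a \<Rightarrow> real ^ 'n" and j
    using that unfolding continuous_map_vec by (intro continuous_map_diff) auto
  show "sup_open X (\<lambda>f. \<forall>x\<in>C. f x \<noteq> c)"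
    unfolding sup_open_def
  proof (intro allI impI, elim conjE)
    fix f :: "'a \<Rightarrow> real ^ 'n" assume f: "continuous_map X euclidean f" "\<forall>x\<in>C. f x \<noteq> c"
    have nz: "\<exists>i<?n. f x $ \<kappa> i - c $ \<kappa> i \<noteq> 0" if x: "x \<in> C" for x
    proof -
      have "f x \<noteq> c" using f(2) x by blast
      then obtain j where j: "f x $ j \<noteq> c $ j" unfolding vec_eq_iff by blast
      show ?thesis by (rule exI[of _ "\<iota> j"]) (use j \<iota>n[of j] \<kappa>\<iota> in simp)
    qed
    obtain r where r: "0 < r" "\<forall>x\<in>C. \<exists>i<?n. r \<le> \<bar>f x $ \<kappa> i - c $ \<kappa> i\<bar>"
      by (rule nonvanishing_bound[OF C(1) comp[OF f(1)] nz])
    show "\<exists>e>0. \<forall>g. continuous_map X euclidean g \<and> (\<forall>x\<in>topspace X. dist (g x) (f x) \<le> e) \<longrightarrow> (\<forall>x\<in>C. g x \<noteq> c)"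
    proof (intro exI[of _ "r/2"] conjI allI impI ballI notI, goal_cases)
      case 1
      then show ?case using r by simp
    next
      case (2 g x)
      then obtain i where i: "r \<le> \<bar>f x $ \<kappa> i - c $ \<kappa> i\<bar>" using r(2) by blast
      have "dist (g x) (f x) \<le> r/2" using 2 CX by blast
      then have "\<bar>g x $ \<kappa> i - f x $ \<kappa> i\<bar> \<le> r/2"
        using component_le_norm_cart[of "g x - f x" "\<kappa> i"] unfolding dist_norm by simp
      moreover have "g x $ \<kappa> i = c $ \<kappa> i" using 2 by simp
      ultimately show False using i r(1) by linarith
    qed
  qed
  show "sup_dense X (\<lambda>f. \<forall>x\<in>C. f x \<noteq> c)"
    unfolding sup_dense_def
  proof (intro allI impI, elim conjE)
    fix f :: "'a \<Rightarrow> real ^ 'n" and e :: real assume f: "continuous_map X euclidean f" and e: "0 < e"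
    have e': "0 < e / real ?n" using e by simp
    have av: "avoidable ?n C" by (rule dim_le_imp_avoidable[OF C])
    obtain w where w: "\<forall>i<?n. continuous_map X euclideanreal (w i)"
      "\<forall>i<?n. \<forall>x\<in>topspace X. \<bar>w i x - (f x $ \<kappa> i - c $ \<kappa> i)\<bar> \<le> e / real ?n" "\<forall>x\<in>C. \<exists>i<?n. w i x \<noteq> 0"
      by (rule avoidableD[OF av comp[OF f] e'])
    define g where "g x = (\<chi> j. c $ j + w (\<iota> j) x)" for x
    have "continuous_map X euclidean g"
      unfolding continuous_map_vec g_def using w(1) \<iota>n by (auto intro!: continuous_map_add)
    moreover have "dist (g x) (f x) \<le> e" if x: "x \<in> topspace X" for x
    proof -
      have "\<bar>g x $ j - f x $ j\<bar> \<le> e / real ?n" for j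
        using w(2)[rule_format, OF \<iota>n[of j] x] unfolding g_def \<kappa>\<iota> by (simp add: algebra_simps)
      then show ?thesis using dist_vec_le[of "g x" "f x" "e / real ?n"] by simp
    qed
    moreover have "g x \<noteq> c" if x: "x \<in> C" for x
    proof
      assume gx: "g x = c"
      obtain i where i: "i < ?n" "w i x \<noteq> 0" using w(3) x by blast
      then obtain j where "i = \<iota> j" using surj by blast
      moreover have "g x $ j = c $ j + w (\<iota> j) x" by (simp add: g_def)
      ultimately show False using i gx by simp
    qed
    ultimately show "\<exists>g. continuous_map X euclidean g \<and> (\<forall>x\<in>topspace X. dist (g x) (f x) \<le> e) \<and> (\<forall>x\<in>C. g x \<noteq> c)"
      by blast
  qed
qed

subsection \<open>Complements of F-sigma sets\<close>

text \<open>Take a map with a stable value \<open>c\<close> and perturb it within the stability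
  radius so that it misses \<open>c\<close> on every set of \<open>\<C>\<close>. The fibre over
  \<open>c\<close> is still of dimension at least \<open>k\<close> and lies in the
  complement.\<close>

lemma not_dim_le_complement:
  assumes dim: "\<not> X dim_le (int CARD('n::finite) + int k - 1)"
    and C: "countable \<C>" "\<And>C. C \<in> \<C> \<Longrightarrow> closedin X C" "\<And>C. C \<in> \<C> \<Longrightarrow> subtopology X C dim_le (int CARD('n) - 1)"
  shows "\<not> subtopology X (topspace X - \<Union>\<C>) dim_le (int k - 1)"
proof
  assume small: "subtopology X (topspace X - \<Union>\<C>) dim_le (int k - 1)"
  have c0: "continuous_map X euclidean (\<lambda>_. 0 :: real ^ 'n)" by simp
  obtain g :: "'a \<Rightarrow> real ^ 'n" and c \<eta> where g: "continuous_map X euclidean g"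
      "\<forall>x\<in>topspace X. dist (g x) 0 \<le> 1" "stable k g c \<eta>"
    by (rule stable_dense[OF dim c0 zero_less_one])
  have \<eta>: "0 < \<eta>" using g(3) unfolding stable_def by blast
  have "sup_dense X (\<lambda>f. \<forall>C\<in>\<C>. \<forall>x\<in>C. f x \<noteq> c)"
    using sup_dense_Inter[OF compact C(1) generic_avoids_value(1)[OF C(2,3)] generic_avoids_value(2)[OF C(2,3)]] .
  from sup_denseD[OF this g(1) \<eta>] obtain h where h: "continuous_map X euclidean h"
      "\<forall>x\<in>topspace X. dist (h x) (g x) \<le> \<eta>" "\<forall>C\<in>\<C>. \<forall>x\<in>C. h x \<noteq> c" .
  have "\<not> subtopology X {x\<in>topspace X. h x = c} dim_le (int k - 1)"
    using g(3) h(1,2) \<eta> unfolding stable_def by simp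
  moreover have "subtopology X {x\<in>topspace X. h x = c} dim_le (int k - 1)"
    by (rule dimension_le_subtopologies[OF small]) (use h(3) in blast)
  ultimately show False by blast
qed

end

lemma small_ind_dim_ge:
  assumes "\<not> Y dim_le (d - 1)"
  shows "ereal (of_int d) \<le> small_ind_dim Y"
  unfolding small_ind_dim_def
proof (rule Inf_greatest)
  fix v assume "v \<in> {ereal (of_int e) |e. Y dim_le e}"
  then obtain e where e: "v = ereal (of_int e)" "Y dim_le e" by blast
  with assms have "d \<le> e" using dimension_le_mono[of Y e "d - 1"] by linarith
  then show "ereal (of_int d) \<le> v" using e by simp
qed

context compact_metric
begin

text \<open>The decomposition by frontiers provides an F-sigma set attaining \<open>k\<close>, and
  \<open>not_dim_le_complement\<close> shows that none does better.\<close>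

lemma fsigma_codim_eq:
  assumes up: "X dim_le (int CARD('n::finite) + int k)" and low: "\<not> X dim_le (int CARD('n) + int k - 1)"
  shows "fsigma_codim CARD('n) X = ereal (of_int (int k))"
proof (rule antisym)
  let ?n = "CARD('n)"
  have n1: "real ?n - 1 = of_int (int ?n - 1)" by simp
  \<comment> \<open>The total \<open>n + k\<close> is split as \<open>(n - 1) + (k + 1)\<close>:
    dimension at most \<open>n - 1\<close> for the closed sets and, since \<open>k + 1\<close>
    stands for dimension \<open>k\<close>, at most \<open>k\<close> for the rest.\<close>
  have "subtopology X (topspace X) dim_le (int ?n - 1 + int (Suc k))"
    using up by (simp add: algebra_simps dimension_le_subtopology)
  then obtain \<C> where C: "countable \<C>" "\<forall>C\<in>\<C>. closedin X C \<and> subtopology X C dim_le (int ?n - 1)"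
        "subtopology X (topspace X - \<Union>\<C>) dim_le (int (Suc k) - 1)"
    using dim_decomposition[OF closedin_topspace, of "int ?n - 1" "Suc k"] by auto
  have "fsigma_in X (\<Union>\<C>)"
    unfolding fsigma_in_def union_of_def using C(1,2) by (intro exI[of _ \<C>]) auto
  moreover have "subtopology X (\<Union>C\<in>\<C>. C) dim_le (int ?n - 1)"
    by (rule dim_le_Union_closed[OF C(1)]) (use C(2) in auto)
  then have "small_ind_dim (subtopology X (\<Union>\<C>)) \<le> ereal (real ?n - 1)"
    unfolding n1 small_ind_dim_le_iff by simp
  ultimately have "fsigma_codim ?n X \<le> small_ind_dim (subtopology X (topspace X - \<Union>\<C>))"
    unfolding fsigma_codim_def by (intro Inf_lower) blast
  also have "\<dots> \<le> ereal (of_int (int k))" unfolding small_ind_dim_le_iff using C(3) by simp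
  finally show "fsigma_codim ?n X \<le> ereal (of_int (int k))" .
  show "ereal (of_int (int k)) \<le> fsigma_codim ?n X"
    unfolding fsigma_codim_def
  proof (rule Inf_greatest)
    fix v assume "v \<in> {small_ind_dim (subtopology X (topspace X - F)) |F.
        fsigma_in X F \<and> small_ind_dim (subtopology X F) \<le> ereal (real ?n - 1)}"
    then obtain F where F: "v = small_ind_dim (subtopology X (topspace X - F))" "fsigma_in X F"
        "small_ind_dim (subtopology X F) \<le> ereal (of_int (int ?n - 1))"
      unfolding n1 by blast
    obtain \<D> where D: "countable \<D>" "\<D> \<subseteq> Collect (closedin X)" "\<Union>\<D> = F"
      using F(2) unfolding fsigma_in_def union_of_def by blast
    have dF: "subtopology X F dim_le (int ?n - 1)" using F(3) unfolding small_ind_dim_le_iff .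
    have cD: "closedin X C" if "C \<in> \<D>" for C using D(2) that by blast
    have dD: "subtopology X C dim_le (int ?n - 1)" if "C \<in> \<D>" for C
      by (rule dimension_le_subtopologies[OF dF]) (use that D(3) in blast)
    have "\<not> subtopology X (topspace X - \<Union>\<D>) dim_le (int k - 1)"
      by (rule not_dim_le_complement[OF low D(1) cD dD])
    then show "ereal (of_int (int k)) \<le> v" unfolding F(1) D(3) by (rule small_ind_dim_ge)
  qed
qed

end

section \<open>Combination of the lower and upper bounds for generic maps\<close>

theorem corollary7p1:
  fixes K :: "'a metric"
  assumes "compact_space (mtopology_of K)"
    and "ereal (real CARD('n::finite)) \<le> small_ind_dim (mtopology_of K)"
    and "small_ind_dim (mtopology_of K) < \<infinity>"
  shows "generically (cont_space K :: ('a \<Rightarrow> real ^ 'n) topology)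
           (\<lambda>f. \<exists>U :: (real ^ 'n) set. open U \<and> U \<noteq> {} \<and>
                (\<forall>y\<in>U. fibre_dim K f y = fsigma_codim CARD('n) (mtopology_of K)))
       \<and> generically (cont_space K :: ('a \<Rightarrow> real ^ 'n) topology)
           (\<lambda>f. fsigma_codim CARD('n) (mtopology_of K) \<in> range (fibre_dim K f) \<and>
                (\<forall>y. fibre_dim K f y \<le> fsigma_codim CARD('n) (mtopology_of K)))"
proof -
  interpret compact_metric K by unfold_locales (rule assms(1))
  let ?n = "CARD('n)"
  \<comment> \<open>Shifting by one makes the dimension a natural number, so that the least bound
    can be taken.\<close>
  have "\<exists>N :: nat. X dim_le (int N - 1)"
  proof -
    have "small_ind_dim X = \<infinity>" if "\<nexists>d. X dim_le d"
      using that by (simp add: small_ind_dim_def top_ereal_def)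
    then obtain d where d: "X dim_le d" using assms(3) by auto
    have "-1 \<le> d" by (rule dimension_le_bound[OF d])
    then have "int (nat (d + 1)) - 1 = d" by simp
    then show ?thesis using d by (intro exI[of _ "nat (d + 1)"]) simp
  qed
  then obtain N where N: "X dim_le (int N - 1)" "\<And>N'. N' < N \<Longrightarrow> \<not> X dim_le (int N' - 1)"
    using exists_least_iff[of "\<lambda>N. X dim_le (int N - 1)"] by auto
  have "ereal (of_int (int ?n)) \<le> ereal (of_int (int N - 1))"
    using order_trans[OF assms(2) small_ind_dim_le_iff[THEN iffD2, OF N(1)]] by simp
  then have "?n + 1 \<le> N" by simp
  \<comment> \<open>The dimension of \<open>K\<close> is \<open>N - 1\<close>, so \<open>k\<close>
    is that dimension minus \<open>n\<close>, which is the value found for the codimension.\<close>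
  define k where "k = N - ?n - 1"
  have k: "N = ?n + k + 1" unfolding k_def using \<open>?n + 1 \<le> N\<close> by simp
  have up: "X dim_le (int ?n + int k)" using N(1) unfolding k by simp
  have low: "\<not> X dim_le (int ?n + int k - 1)" using N(2)[of "?n + k"] unfolding k by simp
  have codim: "fsigma_codim ?n X = ereal (of_int (int k))" by (rule fsigma_codim_eq[OF up low])
  have "subtopology X (topspace X) dim_le (int ?n + int k)" using up by (simp add: dimension_le_subtopology)
  then obtain \<P> :: "(('a \<Rightarrow> real ^ 'n) \<Rightarrow> bool) set" where P: "countable \<P>"
      "\<forall>P\<in>\<P>. sup_open X P \<and> sup_dense X P"
      "\<forall>f. (\<forall>P\<in>\<P>. P f) \<longrightarrow> (\<forall>y. subtopology X {x\<in>topspace X. f x = y} dim_le int k)"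
    using generic_fibre_dim_le[OF closedin_topspace, where 'n='n and k=k] by blast
  \<comment> \<open>This single open dense condition yields the lower bound over an open set of
    values; \<open>\<P>\<close> yields the upper bound over all values.\<close>
  define S :: "('a \<Rightarrow> real ^ 'n) \<Rightarrow> bool" where "S f \<longleftrightarrow> (\<exists>c \<eta>. stable k f c \<eta>)" for f
  have S_open: "sup_open X S" unfolding S_def by (rule sup_open_stable)
  have S_dense: "sup_dense X S"
    unfolding sup_dense_def
  proof (intro allI impI, elim conjE)
    fix f :: "'a \<Rightarrow> real ^ 'n" and e :: real assume "continuous_map X euclidean f" "0 < e"
    then obtain g c \<eta> where "continuous_map X euclidean g" "\<forall>x\<in>topspace X. dist (g x) (f x) \<le> e" "stable k g c \<eta>"
      by (rule stable_dense[OF low])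
    then show "\<exists>g. continuous_map X euclidean g \<and> (\<forall>x\<in>topspace X. dist (g x) (f x) \<le> e) \<and> S g"
      unfolding S_def by blast
  qed
  have cI: "countable (insert S \<P>)" using P(1) by simp
  have op: "\<And>Q. Q \<in> insert S \<P> \<Longrightarrow> sup_open X Q" using S_open P(2) by blast
  have de: "\<And>Q. Q \<in> insert S \<P> \<Longrightarrow> sup_dense X Q" using S_dense P(2) by blast
  have le: "fibre_dim K f y \<le> fsigma_codim ?n X" if "\<forall>Q\<in>insert S \<P>. Q f" for f y
  proof -
    have "subtopology X {x\<in>topspace X. f x = y} dim_le int k" using P(3) that by blast
    then show ?thesis unfolding codim fibre_dim_def small_ind_dim_le_iff by simp
  qed
  have eq: "\<exists>U :: (real ^ 'n) set. open U \<and> U \<noteq> {} \<and> (\<forall>y\<in>U. fibre_dim K f y = fsigma_codim ?n X)"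
    if f: "continuous_map X euclidean f" "\<forall>Q\<in>insert S \<P>. Q f" for f
  proof -
    have "S f" using f(2) by blast
    then obtain c \<eta> where st: "stable k f c \<eta>" unfolding S_def by blast
    then have \<eta>: "0 < \<eta>" unfolding stable_def by blast
    \<comment> \<open>Here stability is applied to \<open>f\<close> itself, with only the value
      varying.\<close>
    have "fibre_dim K f y = fsigma_codim ?n X" if y: "y \<in> ball c \<eta>" for y
    proof (rule antisym)
      show "fibre_dim K f y \<le> fsigma_codim ?n X" by (rule le[OF f(2)])
      have "dist y c \<le> \<eta>" using y by (simp add: dist_commute)
      moreover have "\<forall>x\<in>topspace X. dist (f x) (f x) \<le> \<eta>" using \<eta> by simp
      ultimately have "\<not> subtopology X {x\<in>topspace X. f x = y} dim_le (int k - 1)"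
        using st f(1) unfolding stable_def by blast
      then show "fsigma_codim ?n X \<le> fibre_dim K f y"
        unfolding codim fibre_dim_def by (intro small_ind_dim_ge) simp
    qed
    then show ?thesis using \<eta> by (intro exI[of _ "ball c \<eta>"]) auto
  qed
  show ?thesis
  proof
    show "generically (cont_space K :: ('a \<Rightarrow> real ^ 'n) topology)
           (\<lambda>f. \<exists>U :: (real ^ 'n) set. open U \<and> U \<noteq> {} \<and> (\<forall>y\<in>U. fibre_dim K f y = fsigma_codim ?n X))"
    proof (rule generically_countable[OF assms(1) cI op de])
      fix f :: "'a \<Rightarrow> real ^ 'n"
      assume f: "continuous_map X euclidean f" and Q: "\<And>Q. Q \<in> insert S \<P> \<Longrightarrow> Q f"
      show "\<exists>U :: (real ^ 'n) set. open U \<and> U \<noteq> {} \<and> (\<forall>y\<in>U. fibre_dim K f y = fsigma_codim ?n X)"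
        by (rule eq[OF f]) (rule ballI, rule Q)
    qed
    show "generically (cont_space K :: ('a \<Rightarrow> real ^ 'n) topology)
           (\<lambda>f. fsigma_codim ?n X \<in> range (fibre_dim K f) \<and> (\<forall>y. fibre_dim K f y \<le> fsigma_codim ?n X))"
    proof (rule generically_countable[OF assms(1) cI op de])
      fix f :: "'a \<Rightarrow> real ^ 'n"
      assume fc: "continuous_map X euclidean f" and Q: "\<And>Q. Q \<in> insert S \<P> \<Longrightarrow> Q f"
      have f: "continuous_map X euclidean f" "\<forall>Q\<in>insert S \<P>. Q f"
        by (rule fc, rule ballI, rule Q)
      obtain U :: "(real ^ 'n) set" where "U \<noteq> {}" "\<forall>y\<in>U. fibre_dim K f y = fsigma_codim ?n X"
        using eq[OF f] by blast
      then have "fsigma_codim ?n X \<in> range (fibre_dim K f)" by (metis ex_in_conv rangeI)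
      then show "fsigma_codim ?n X \<in> range (fibre_dim K f) \<and> (\<forall>y. fibre_dim K f y \<le> fsigma_codim ?n X)"
        using le[OF f(2)] by blast
    qed
  qed
qed

end
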